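(* Let $q$ be a power of a prime $p$, $K$ an algebraic closure of $\mathbb{F}_q$, and let $\overline{\mathrm{AGL}}(2,q)$ denote the stabilizer in $\mathrm{PGL}(3,q)$ of a point of $\mathrm{PG}(2,q)$, acting on $\mathrm{PG}(2,K)$. Then $d(\overline{\mathrm{AGL}}(2,q))=q^3-q^2$.
   Context: Plane curves are projective plane curves over $K$; irreducible means irreducible over $K$; a curve is $G$-invariant if every element of $G$ maps it onto itself. $d(G)$ is the smallest degree of a $G$-invariant irreducible plane curve other than a line (it does not depend on the choice of the point, up to conjugacy). *)

theory Defs
  imports "HOL-Analysis.Analysis" "HOL-Computational_Algebra.Polynomial"
    "HOL-Computational_Algebra.Factorial_Ring"
begin

text \<open>Ternary forms over a field 'k are elements of 'k poly poly poly:
  the innermost variable is X (coordinate 1), the middle one Y (coordinate 2),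
  the outermost one Z (coordinate 3).  A projective plane curve of degree d is
  a nonzero homogeneous form of degree d, up to a nonzero scalar factor.\<close>

type_synonym 'k form3 = "'k poly poly poly"

definition const3 :: "'k::comm_ring_1 \<Rightarrow> 'k form3" where
  "const3 c = [:[:[:c:]:]:]"

definition varX :: "'k::comm_ring_1 form3" where "varX = [:[:[:0, 1:]:]:]"
definition varY :: "'k::comm_ring_1 form3" where "varY = [:[:0, 1:]:]"
definition varZ :: "'k::comm_ring_1 form3" where "varZ = [:0, 1:]"

definition subst3 :: "'k::comm_ring_1 form3 \<Rightarrow> 'k form3 \<Rightarrow> 'k form3 \<Rightarrow> 'k form3 \<Rightarrow> 'k form3" where
  "subst3 F u v w =
     poly (map_poly (\<lambda>g. poly (map_poly (\<lambda>f. poly (map_poly const3 f) u) g) v) F) w"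

definition coeff3 :: "'k::zero form3 \<Rightarrow> nat \<Rightarrow> nat \<Rightarrow> nat \<Rightarrow> 'k" where
  "coeff3 F i j k = coeff (coeff (coeff F k) j) i"

definition homogeneous3 :: "'k::zero form3 \<Rightarrow> nat \<Rightarrow> bool" where
  "homogeneous3 F d \<longleftrightarrow> F \<noteq> 0 \<and> (\<forall>i j k. coeff3 F i j k \<noteq> 0 \<longrightarrow> i + j + k = d)"

definition lin_form :: "'k::comm_ring_1 ^3 \<Rightarrow> 'k form3" where
  "lin_form r = const3 (r $ 1) * varX + const3 (r $ 2) * varY + const3 (r $ 3) * varZ"

definition act3 :: "'k::comm_ring_1 ^3^3 \<Rightarrow> 'k form3 \<Rightarrow> 'k form3" where
  "act3 A F = subst3 F (lin_form (A $ 1)) (lin_form (A $ 2)) (lin_form (A $ 3))"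

definition invariant_curve :: "('k::field ^3^3) set \<Rightarrow> 'k form3 \<Rightarrow> bool" where
  "invariant_curve G F \<longleftrightarrow> (\<forall>A\<in>G. \<exists>c. c \<noteq> 0 \<and> act3 A F = const3 c * F)"

definition Fq :: "nat \<Rightarrow> 'k::field set" where
  "Fq q = {x. x ^ q = x}"

text \<open>Stabilizer in PGL(3,q) of the point P of PG(2,q) (matrices representing
  its elements; scalar multiples represent the same projectivity).\<close>
definition stab_AGL :: "nat \<Rightarrow> 'k::field ^3 \<Rightarrow> ('k ^3^3) set" where
  "stab_AGL q P = {A. (\<forall>i j. A $ i $ j \<in> Fq q) \<and> det A \<noteq> 0 \<and> (\<exists>l. A *v P = l *s P)}"

definition inv_curve_degrees :: "('k::field ^3^3) set \<Rightarrow> nat set" where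
  "inv_curve_degrees G =
     {d. d \<noteq> 1 \<and> (\<exists>F::'k form3. homogeneous3 F d \<and> irreducible F \<and> invariant_curve G F)}"

end

(* Put the fixed point at (0,0,1). The maps Z -> Z + eX + fY with e, f in F_q form an elementary
   abelian group T of order q^2, and N = Z^(q^2) - Q Z^q + L^(q-1) Z is the product of the Z - eX - fY,
   where L = X Y^q - X^q Y and Q = (X Y^(q^2) - X^(q^2) Y) / L are the Dickson invariants.

   Lower bound: an invariant form F is a polynomial in N over K[X,Y], so q^2 divides its degree D in Z.
   Unless Z divides F, the maps Z -> lZ fix F, so q - 1 divides D. Finally D = 0 would make F a binary
   form, hence a product of linear forms.

   Existence: F = N^(q-1) + Q^q is invariant of degree q^3 - q^2. For its irreducibility put Y = 1 and
   let F = A C with A, C monic in Z. At each point of the line X = 0 the Newton polygon of F is one edge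
   from Z^q to X^(q-1), so F is locally irreducible there and A, C have no common zero on that line.
   A translation in T that is trivial on the line changes neither A nor C modulo X, hence fixes A and C
   by uniqueness in Hensel's lemma. The lines X = 0 and X = 1 together give invariance under all of T,
   so A and C are polynomials in N, and W^(q-1) + Q^q is irreducible because q - 1 and q are coprime
   and Q has a simple root. *)
theory Submission
  imports Defs "HOL-Computational_Algebra.Primes"
begin

section \<open>Dickson invariants\<close>

definition rhom :: "('a::comm_ring_1 \<Rightarrow> 'b::comm_ring_1) \<Rightarrow> bool" where
  "rhom h \<longleftrightarrow> h 1 = 1 \<and> (\<forall>x y. h (x + y) = h x + h y) \<and> (\<forall>x y. h (x * y) = h x * h y)"

lemma rhom_add: "rhom h \<Longrightarrow> h (x + y) = h x + h y"
  and rhom_mult: "rhom h \<Longrightarrow> h (x * y) = h x * h y"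
  and rhom_1: "rhom h \<Longrightarrow> h 1 = 1"
  by (simp_all add: rhom_def)

lemma rhom_0: "rhom h \<Longrightarrow> h 0 = 0"
  by (metis add_cancel_right_right rhom_add)

lemma rhom_uminus: "rhom h \<Longrightarrow> h (- x) = - h x"
  by (metis add.right_inverse minus_unique rhom_0 rhom_add)

lemma rhom_diff: "rhom h \<Longrightarrow> h (x - y) = h x - h y"
  by (metis diff_conv_add_uminus rhom_add rhom_uminus)

lemma rhom_power: "rhom h \<Longrightarrow> h (x ^ n) = h x ^ n"
  by (induction n) (simp_all add: rhom_1 rhom_mult)

lemma rhom_sum: "rhom h \<Longrightarrow> h (sum f A) = (\<Sum>i\<in>A. h (f i))"
  by (induction A rule: infinite_finite_induct) (simp_all add: rhom_0 rhom_add)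

lemmas rhom_simps = rhom_add rhom_mult rhom_1 rhom_0 rhom_uminus rhom_diff rhom_power rhom_sum

lemma rhom_comp: "rhom g \<Longrightarrow> rhom h \<Longrightarrow> rhom (\<lambda>x. g (h x))"
  by (simp add: rhom_def)

lemma rhom_dvd:
  assumes "rhom h" "x dvd y"
  shows "h x dvd h y"
proof -
  obtain k where "y = x * k" using assms(2) by (rule dvdE)
  then have "h y = h x * h k" using rhom_mult[OF assms(1)] by simp
  then show ?thesis by (rule dvdI)
qed

lemma rhom_poly: "rhom (\<lambda>p. poly p a)"
  by (simp add: rhom_def)

lemma rhom_pcompose: "rhom (\<lambda>p. pcompose p r)"
  by (simp add: rhom_def pcompose_1 pcompose_add pcompose_mult)

lemma rhom_const: "rhom (\<lambda>c. [:c:])"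
  by (simp add: rhom_def)

lemma rhom_map_poly:
  assumes h: "rhom h" shows "rhom (map_poly h)"
  unfolding rhom_def
proof (intro conjI allI)
  show "map_poly h 1 = 1" by (simp add: rhom_1[OF h])
  show "map_poly h (p + q) = map_poly h p + map_poly h q" for p q
    by (rule poly_eqI) (simp add: coeff_map_poly rhom_simps[OF h])
  show "map_poly h (p * q) = map_poly h p * map_poly h q" for p q
    by (rule poly_eqI) (simp add: coeff_map_poly coeff_mult rhom_simps[OF h])
qed

lemma rhom_eval_map: "rhom h \<Longrightarrow> rhom (\<lambda>p. poly (map_poly h p) w)"
  using rhom_comp[OF rhom_poly rhom_map_poly] .

definition dickL :: "nat \<Rightarrow> 'a::comm_ring_1 \<Rightarrow> 'a \<Rightarrow> 'a" where
  "dickL q X Y = X * Y ^ q - X ^ q * Y"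

text \<open>Equal to (X Y^(q^2) - X^(q^2) Y) / dickL q X Y, see dickQ_mult_dickL.\<close>

definition dickQ :: "nat \<Rightarrow> 'a::comm_ring_1 \<Rightarrow> 'a \<Rightarrow> 'a" where
  "dickQ q X Y = (\<Sum>i\<le>q. X ^ ((q - 1) * i) * Y ^ ((q - 1) * (q - i)))"

definition orbN :: "nat \<Rightarrow> 'a::comm_ring_1 \<Rightarrow> 'a \<Rightarrow> 'a \<Rightarrow> 'a" where
  "orbN q X Y Z = Z ^ q\<^sup>2 - dickQ q X Y * Z ^ q + dickL q X Y ^ (q - 1) * Z"

definition orbF :: "nat \<Rightarrow> 'a::comm_ring_1 \<Rightarrow> 'a \<Rightarrow> 'a \<Rightarrow> 'a" where
  "orbF q X Y Z = orbN q X Y Z ^ (q - 1) + dickQ q X Y ^ q"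

lemma rhom_dickL: "rhom h \<Longrightarrow> h (dickL q X Y) = dickL q (h X) (h Y)"
  and rhom_dickQ: "rhom h \<Longrightarrow> h (dickQ q X Y) = dickQ q (h X) (h Y)"
  by (simp_all add: dickL_def dickQ_def rhom_simps)

lemma rhom_orbN: "rhom h \<Longrightarrow> h (orbN q X Y Z) = orbN q (h X) (h Y) (h Z)"
  by (simp add: orbN_def rhom_simps rhom_dickL rhom_dickQ)

lemma rhom_orbF: "rhom h \<Longrightarrow> h (orbF q X Y Z) = orbF q (h X) (h Y) (h Z)"
  by (simp add: orbF_def rhom_simps rhom_orbN rhom_dickQ)

lemma dickQ_mult_dickL:
  assumes "q \<ge> 1"
  shows "dickQ q X Y * dickL q X Y = X * Y ^ q\<^sup>2 - X ^ q\<^sup>2 * Y"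
proof -
  define a b where "a = X ^ (q - 1)" and "b = Y ^ (q - 1)"
  have Q: "dickQ q X Y = (\<Sum>i<Suc q. b ^ (Suc q - Suc i) * a ^ i)"
    by (simp add: dickQ_def a_def b_def power_mult [symmetric] mult.commute lessThan_Suc_atMost)
  have e: "a ^ Suc q - b ^ Suc q = (a - b) * dickQ q X Y"
    unfolding Q by (rule power_diff_sumr2)
  have pw: "x * (x ^ (q - 1)) ^ Suc q = x ^ q\<^sup>2" "x * x ^ (q - 1) = x ^ q" for x :: 'a
  proof -
    have "Suc ((q - 1) * Suc q) = q\<^sup>2"
      using assms by (cases q) (auto simp: power2_eq_square)
    then show "x * (x ^ (q - 1)) ^ Suc q = x ^ q\<^sup>2"
      by (metis power_Suc power_mult)
    show "x * x ^ (q - 1) = x ^ q" using assms by (cases q) auto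
  qed
  have L: "dickL q X Y = - (X * Y * (a - b))"
    by (simp add: dickL_def a_def b_def algebra_simps flip: pw(2))
  have "dickQ q X Y * dickL q X Y = - (X * Y * ((a - b) * dickQ q X Y))"
    by (simp add: L algebra_simps)
  also have "\<dots> = - (X * Y * (a ^ Suc q - b ^ Suc q))"
    by (simp only: e)
  also have "\<dots> = X * (Y * b ^ Suc q) - (X * a ^ Suc q) * Y"
    by (simp only: right_diff_distrib mult.assoc mult.commute mult.left_commute minus_diff_eq)
  also have "\<dots> = X * Y ^ q\<^sup>2 - X ^ q\<^sup>2 * Y"
    unfolding a_def b_def by (simp only: pw(1))
  finally show ?thesis .
qed

lemma orbN_scale:
  assumes "c ^ q = c"
  shows "orbN q X Y (c * Z) = c * orbN q X Y Z"
proof -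
  have "c ^ q\<^sup>2 = c" using assms by (simp add: power2_eq_square power_mult)
  then show ?thesis using assms by (simp add: orbN_def power_mult_distrib algebra_simps)
qed

locale frobenius_ring =
  fixes p m q :: nat and ty :: "'a::comm_ring_1 itself"
  assumes prime_p: "prime p" and m_ge_1: "m \<ge> 1" and q_def: "q = p ^ m" and char_p: "of_nat p = (0::'a)"
begin

lemma q2: "q \<ge> 2"
proof -
  have "p ^ 1 \<le> p ^ m" using m_ge_1 prime_gt_0_nat[OF prime_p] by (intro power_increasing) auto
  then show ?thesis using prime_ge_2_nat[OF prime_p] q_def by simp
qed

lemma q0: "of_nat q = (0::'a)"
  using m_ge_1 by (simp add: q_def char_p power_0_left)

lemma frob: "(x + y :: 'a) ^ q = x ^ q + y ^ q"
proof -
  have "CHAR('a) dvd p" using char_p of_nat_eq_0_iff_char_dvd by blast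
  then have "CHAR('a) = p" using prime_p CHAR_not_1[where 'a='a] prime_nat_iff by (metis One_nat_def)
  then show ?thesis using freshmans_dream'[of q m x y] prime_p q_def by simp
qed

lemma frobenius_ring_poly: "frobenius_ring TYPE('a poly) p m q"
  using prime_p m_ge_1 by unfold_locales (simp_all add: q_def char_p of_nat_poly)

lemma frob_minus: "(- x :: 'a) ^ q = - (x ^ q)"
proof -
  have "x ^ q + (- x) ^ q = (x + - x) ^ q" by (rule frob[symmetric])
  also have "\<dots> = 0" using q2 by (simp add: power_0_left)
  finally show ?thesis by (simp add: eq_neg_iff_add_eq_0 add.commute)
qed

lemma frob_diff: "(x - y :: 'a) ^ q = x ^ q - y ^ q"
  using frob[of x "- y"] by (simp add: frob_minus)

lemma frob2: "(x + y :: 'a) ^ q\<^sup>2 = x ^ q\<^sup>2 + y ^ q\<^sup>2"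
  by (simp add: power2_eq_square power_mult frob)

lemma orbN_add: "orbN q X Y (Z + W :: 'a) = orbN q X Y Z + orbN q X Y W"
  by (simp add: orbN_def frob frob2 algebra_simps)

lemma dickL_linear:
  fixes X Y :: 'a
  assumes "a ^ q = a" "b ^ q = b" "c ^ q = c" "d ^ q = d"
  shows "dickL q (a * X + b * Y) (c * X + d * Y) = (a * d - b * c) * dickL q X Y"
  using assms by (simp add: dickL_def frob power_mult_distrib algebra_simps)

end

locale frobenius_idom = frobenius_ring p m q ty for p m q and ty :: "'a::idom itself"
begin

lemma frobenius_idom_poly: "frobenius_idom TYPE('a poly) p m q"
  by (rule frobenius_idom.intro[OF frobenius_ring_poly])

lemma orbN_X:
  assumes "dickL q X Y \<noteq> (0::'a)"
  shows "orbN q X Y X = 0" "orbN q X Y Y = 0"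
proof -
  let ?L = "dickL q X Y" and ?Q = "dickQ q X Y"
  have Lq: "?L * ?L ^ (q - 1) = X ^ q * Y ^ q\<^sup>2 - X ^ q\<^sup>2 * Y ^ q"
  proof -
    have "?L * ?L ^ (q - 1) = ?L ^ q" using q2 by (cases q) auto
    also have "\<dots> = X ^ q * Y ^ q\<^sup>2 - X ^ q\<^sup>2 * Y ^ q"
      by (simp add: dickL_def frob_diff power_mult_distrib power2_eq_square power_mult)
    finally show ?thesis .
  qed
  have QL: "?Q * ?L = X * Y ^ q\<^sup>2 - X ^ q\<^sup>2 * Y" by (rule dickQ_mult_dickL) (use q2 in simp)
  have *: "?L * orbN q X Y z = ?L * z ^ q\<^sup>2 - (X * Y ^ q\<^sup>2 - X ^ q\<^sup>2 * Y) * z ^ q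
      + (X ^ q * Y ^ q\<^sup>2 - X ^ q\<^sup>2 * Y ^ q) * z" for z
    unfolding QL[symmetric] Lq[symmetric] by (simp add: orbN_def algebra_simps)
  have "?L * orbN q X Y X = 0" unfolding * by (simp add: dickL_def algebra_simps)
  then show "orbN q X Y X = 0" using assms by simp
  have "?L * orbN q X Y Y = 0" unfolding * by (simp add: dickL_def algebra_simps)
  then show "orbN q X Y Y = 0" using assms by simp
qed

lemma orbN_translation:
  assumes "dickL q X Y \<noteq> (0::'a)" "e ^ q = e" "f ^ q = f"
  shows "orbN q X Y (e * X + f * Y) = 0"
  using assms by (simp add: orbN_add orbN_scale orbN_X)

lemma dickQ_linear:
  assumes "dickL q X Y \<noteq> (0::'a)" "a ^ q = a" "b ^ q = b" "c ^ q = c" "d ^ q = d" "a * d - b * c \<noteq> 0"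
  shows "dickQ q (a * X + b * Y) (c * X + d * Y) = dickQ q X Y"
proof -
  let ?X = "a * X + b * Y" and ?Y = "c * X + d * Y"
  have fx: "x ^ q\<^sup>2 = x" if "x ^ q = x" for x :: 'a
    using that by (simp add: power2_eq_square power_mult)
  have "dickQ q ?X ?Y * dickL q ?X ?Y = ?X * ?Y ^ q\<^sup>2 - ?X ^ q\<^sup>2 * ?Y"
    by (rule dickQ_mult_dickL) (use q2 in simp)
  also have "\<dots> = (a * d - b * c) * (X * Y ^ q\<^sup>2 - X ^ q\<^sup>2 * Y)"
    using assms by (simp add: frob2 power_mult_distrib fx algebra_simps)
  also have "\<dots> = (a * d - b * c) * (dickQ q X Y * dickL q X Y)"
    using dickQ_mult_dickL[of q X Y] q2 by auto
  finally have "dickQ q ?X ?Y * ((a * d - b * c) * dickL q X Y) = dickQ q X Y * ((a * d - b * c) * dickL q X Y)"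
    unfolding dickL_linear[OF assms(2-5)] by (simp only: mult_ac)
  then show ?thesis using assms by simp
qed

lemma orbF_linear:
  assumes L: "dickL q X Y \<noteq> (0::'a)" and fx: "a ^ q = a" "b ^ q = b" "c ^ q = c" "d ^ q = d"
    "e ^ q = e" "f ^ q = f" "l ^ q = l"
    and det: "a * d - b * c \<noteq> 0" and "l \<noteq> 0"
  shows "orbF q (a * X + b * Y) (c * X + d * Y) (e * X + f * Y + l * Z) = orbF q X Y Z"
proof -
  have one: "x ^ (q - 1) = 1" if "x ^ q = x" "x \<noteq> 0" for x :: 'a
  proof -
    have "x * x ^ (q - 1) = x * 1" using that q2 by (cases q) auto
    then show ?thesis using that by simp
  qed
  let ?dt = "a * d - b * c"
  have "?dt ^ q = ?dt" using fx by (simp add: frob_diff power_mult_distrib)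
  then have "dickL q (a * X + b * Y) (c * X + d * Y) ^ (q - 1) = dickL q X Y ^ (q - 1)"
    using one[OF _ det] fx by (simp add: dickL_linear power_mult_distrib)
  then have "orbN q (a * X + b * Y) (c * X + d * Y) = orbN q X Y"
    using assms by (intro ext) (simp add: orbN_def dickQ_linear)
  moreover have "orbN q X Y (e * X + f * Y + l * Z) = l * orbN q X Y Z"
    using assms orbN_add[of X Y "e * X + f * Y" "l * Z"] by (simp add: orbN_translation orbN_scale)
  ultimately show ?thesis
    using assms one[of l] by (simp add: orbF_def dickQ_linear power_mult_distrib)
qed

end

section \<open>Factorizations of bivariate polynomials\<close>

lemma binomial_mod_square:
  fixes a u :: "'a::comm_ring_1"
  shows "\<exists>V. (a + u) ^ k = a ^ k + of_nat k * a ^ (k - 1) * u + u\<^sup>2 * V"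
proof (induction k)
  case 0
  show ?case by (rule exI[of _ 0]) simp
next
  case (Suc k)
  then obtain V where V: "(a + u) ^ k = a ^ k + of_nat k * a ^ (k - 1) * u + u\<^sup>2 * V" by blast
  have "of_nat k * (a * a ^ (k - 1)) = (of_nat k * a ^ k :: 'a)" by (cases k) auto
  then have "(a + u) ^ Suc k = a ^ Suc k + of_nat (Suc k) * a ^ (Suc k - 1) * u
      + u\<^sup>2 * (a * V + u * V + of_nat k * a ^ (k - 1))"
    by (simp add: V power2_eq_square algebra_simps)
  then show ?case by blast
qed

lemma coeff2_mult:
  fixes A C :: "'a::comm_semiring_0 poly poly"
  shows "coeff (coeff (A * C) n) m
    = (\<Sum>(k,l)\<in>{..n}\<times>{..m}. coeff (coeff A k) l * coeff (coeff C (n - k)) (m - l))"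
  by (simp add: coeff_mult coeff_sum sum.cartesian_product)

lemma coeff2_mult_nonzero:
  fixes A C :: "'a::comm_semiring_0 poly poly"
  assumes "coeff (coeff (A * C) n) m \<noteq> 0"
  obtains k l where "k \<le> n" "l \<le> m" "coeff (coeff A k) l \<noteq> 0" "coeff (coeff C (n - k)) (m - l) \<noteq> 0"
proof -
  obtain x where "x \<in> {..n} \<times> {..m}"
    "(case x of (k,l) \<Rightarrow> coeff (coeff A k) l * coeff (coeff C (n - k)) (m - l)) \<noteq> 0"
    using assms sum.not_neutral_contains_not_neutral unfolding coeff2_mult by blast
  then show ?thesis using that by (cases x) force
qed

lemma lowest_weight_monomial:
  fixes A :: "'a::zero poly poly" and r s :: nat
  assumes "A \<noteq> 0"
  obtains i j where "coeff (coeff A j) i \<noteq> 0"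
    "\<And>i' j'. coeff (coeff A j') i' \<noteq> 0 \<Longrightarrow> r * i + s * j \<le> r * i' + s * j'"
    "\<And>i' j'. coeff (coeff A j') i' \<noteq> 0 \<Longrightarrow> r * i' + s * j' = r * i + s * j \<Longrightarrow> j \<le> j'"
proof -
  have "\<exists>x. coeff (coeff A (snd x)) (fst x) \<noteq> 0"
    using assms by (metis fst_conv leading_coeff_0_iff snd_conv)
  then obtain x where x: "coeff (coeff A (snd x)) (fst x) \<noteq> 0"
    "\<And>y. coeff (coeff A (snd y)) (fst y) \<noteq> 0 \<Longrightarrow> r * fst x + s * snd x \<le> r * fst y + s * snd y"
    using ex_has_least_nat[of "\<lambda>x. coeff (coeff A (snd x)) (fst x) \<noteq> 0" _ "\<lambda>x. r * fst x + s * snd x"]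
    by blast
  obtain y where y: "coeff (coeff A (snd y)) (fst y) \<noteq> 0" "r * fst y + s * snd y = r * fst x + s * snd x"
    "\<And>z. coeff (coeff A (snd z)) (fst z) \<noteq> 0 \<Longrightarrow> r * fst z + s * snd z = r * fst x + s * snd x \<Longrightarrow> snd y \<le> snd z"
    using ex_has_least_nat[of "\<lambda>z. coeff (coeff A (snd z)) (fst z) \<noteq> 0 \<and> r * fst z + s * snd z = r * fst x + s * snd x" x snd]
      x(1) by blast
  show ?thesis
  proof (rule that[of "snd y" "fst y"])
    show "coeff (coeff A (snd y)) (fst y) \<noteq> 0" by (rule y(1))
    show "r * fst y + s * snd y \<le> r * i' + s * j'" if "coeff (coeff A j') i' \<noteq> 0" for i' j'
      using x(2)[of "(i',j')"] that y(2) by simp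
    show "snd y \<le> j'" if "coeff (coeff A j') i' \<noteq> 0" "r * i' + s * j' = r * fst y + s * snd y" for i' j'
      using y(3)[of "(i',j')"] that y(2) by simp
  qed
qed

text \<open>In an element of 'a poly poly the inner variable is x and the outer one is t. The Newton polygon
  of the product at the origin is the edge from t ^ r to x ^ s, and its only lattice points are the
  end points since r and s are coprime.\<close>

lemma local_irreducibility:
  fixes A C G H :: "'a::idom poly poly"
  assumes cop: "coprime r s" and "r > 0" "s > 0"
    and AC: "A * C = monom 1 r * G + smult (monom 1 s) H"
    and G: "coeff (coeff G 0) 0 \<noteq> 0" and H: "coeff (coeff H 0) 0 \<noteq> 0"
  shows "coeff (coeff A 0) 0 \<noteq> 0 \<or> coeff (coeff C 0) 0 \<noteq> 0"
proof -
  have AC': "coeff (coeff (A * C) j) i =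
     (if j < r then 0 else coeff (coeff G (j - r)) i) + (if i < s then 0 else coeff (coeff H j) (i - s))" for i j
    by (simp add: AC coeff_monom_mult)
  have ACs: "coeff (coeff (A * C) 0) s \<noteq> 0" using AC'[of 0 s] H \<open>r > 0\<close> by simp
  have ACr: "coeff (coeff (A * C) r) 0 \<noteq> 0" using AC'[of r 0] G \<open>s > 0\<close> by simp
  have "A \<noteq> 0" "C \<noteq> 0" using ACs by auto
  obtain i1 j1 where 1: "coeff (coeff A j1) i1 \<noteq> 0"
    "\<And>i' j'. coeff (coeff A j') i' \<noteq> 0 \<Longrightarrow> r * i1 + s * j1 \<le> r * i' + s * j'"
    "\<And>i' j'. coeff (coeff A j') i' \<noteq> 0 \<Longrightarrow> r * i' + s * j' = r * i1 + s * j1 \<Longrightarrow> j1 \<le> j'"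
    using lowest_weight_monomial[OF \<open>A \<noteq> 0\<close>] by metis
  obtain i2 j2 where 2: "coeff (coeff C j2) i2 \<noteq> 0"
    "\<And>i' j'. coeff (coeff C j') i' \<noteq> 0 \<Longrightarrow> r * i2 + s * j2 \<le> r * i' + s * j'"
    "\<And>i' j'. coeff (coeff C j') i' \<noteq> 0 \<Longrightarrow> r * i' + s * j' = r * i2 + s * j2 \<Longrightarrow> j2 \<le> j'"
    using lowest_weight_monomial[OF \<open>C \<noteq> 0\<close>] by metis
  define mA mC where "mA = r * i1 + s * j1" and "mC = r * i2 + s * j2"
  let ?f = "\<lambda>(k,l). coeff (coeff A k) l * coeff (coeff C (j1 + j2 - k)) (i1 + i2 - l)"
  have "(\<Sum>x\<in>{..j1+j2}\<times>{..i1+i2}. ?f x) = (\<Sum>x\<in>{(j1,i1)}. ?f x)"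
  proof (rule sum.mono_neutral_right)
    show "\<forall>x\<in>{..j1+j2}\<times>{..i1+i2} - {(j1,i1)}. ?f x = 0"
    proof (rule ballI, rule ccontr)
      fix x assume x: "x \<in> {..j1+j2}\<times>{..i1+i2} - {(j1,i1)}" and "?f x \<noteq> 0"
      obtain k l where kl: "x = (k,l)" by (cases x)
      have nz: "coeff (coeff A k) l \<noteq> 0" "coeff (coeff C (j1 + j2 - k)) (i1 + i2 - l) \<noteq> 0"
        using \<open>?f x \<noteq> 0\<close> kl by auto
      define k' l' where "k' = j1 + j2 - k" and "l' = i1 + i2 - l"
      have kl': "k + k' = j1 + j2" "l + l' = i1 + i2" using x kl by (auto simp: k'_def l'_def)
      have "r * (l + l') + s * (k + k') = mA + mC"
        unfolding kl' mA_def mC_def by (simp add: algebra_simps)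
      then have sm: "(r * l + s * k) + (r * l' + s * k') = mA + mC" by (simp add: algebra_simps)
      have "mA \<le> r * l + s * k" "mC \<le> r * l' + s * k'"
        using 1(2)[OF nz(1)] 2(2)[OF nz(2)] by (simp_all add: mA_def mC_def k'_def l'_def)
      then have e: "r * l + s * k = mA" "r * l' + s * k' = mC" using sm by linarith+
      then have "j1 \<le> k" "j2 \<le> k'"
        using 1(3)[OF nz(1)] 2(3)[OF nz(2)] by (simp_all add: mA_def mC_def k'_def l'_def)
      then have "k = j1" using kl' by linarith
      then have "l = i1" using e(1) \<open>r > 0\<close> by (simp add: mA_def)
      then show False using \<open>k = j1\<close> x kl by auto
    qed
  qed auto
  also have "\<dots> \<noteq> 0" using 1(1) 2(1) by simp
  finally have "coeff (coeff (A * C) (j1 + j2)) (i1 + i2) \<noteq> 0" by (simp add: coeff2_mult)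
  then have "r \<le> j1 + j2 \<or> s \<le> i1 + i2" using AC'[of "j1 + j2" "i1 + i2"] by (auto split: if_splits)
  then have "r * s \<le> r * (i1 + i2) + s * (j1 + j2)"
    by (metis add_leD1 add_leD2 le_add1 le_add2 mult.commute mult_le_mono2 order_trans)
  then have ge: "r * s \<le> mA + mC" by (simp add: mA_def mC_def algebra_simps)
  obtain l where l: "l \<le> s" "coeff (coeff A 0) l \<noteq> 0" "coeff (coeff C 0) (s - l) \<noteq> 0"
    using coeff2_mult_nonzero[OF ACs] by auto
  obtain k where k: "k \<le> r" "coeff (coeff A k) 0 \<noteq> 0" "coeff (coeff C (r - k)) 0 \<noteq> 0"
    using coeff2_mult_nonzero[OF ACr] by auto
  have "mA \<le> r * l" "mC \<le> r * (s - l)" "mA \<le> s * k" "mC \<le> s * (r - k)"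
    using 1(2)[OF l(2)] 2(2)[OF l(3)] 1(2)[OF k(2)] 2(2)[OF k(3)] by (auto simp: mA_def mC_def)
  moreover have "r * l + r * (s - l) = r * s" using l(1) by (simp flip: distrib_left)
  moreover have "s * k + s * (r - k) = r * s" using k(1) by (simp flip: distrib_left)
  ultimately have "r * l = s * k" using ge by linarith
  then have "s dvd r * l" by simp
  then have "s dvd l" using cop by (simp add: coprime_commute coprime_dvd_mult_right_iff)
  then have "l = 0 \<or> l = s" using l(1) by (auto elim!: dvdE)
  then show ?thesis using l by auto
qed

lemma dvd_if_dvd_mult_no_common_root:
  fixes a c D :: "'a::field poly"
  assumes closed: "\<forall>f::'a poly. degree f > 0 \<longrightarrow> (\<exists>x. poly f x = 0)"
    and "a \<noteq> 0" "\<And>x. poly a x = 0 \<Longrightarrow> poly c x \<noteq> 0" "a dvd D * c"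
  shows "a dvd D"
  using assms(2-)
proof (induction "degree a" arbitrary: a D)
  case 0
  then have "is_unit a" by (simp add: is_unit_iff_degree)
  then show ?case by (rule unit_imp_dvd)
next
  case (Suc n)
  obtain x where x: "poly a x = 0" using closed Suc(2) by (metis zero_less_Suc)
  then obtain a1 where a1: "a = [:- x, 1:] * a1" by (auto simp: poly_eq_0_iff_dvd)
  have "a1 \<noteq> 0" using a1 Suc by auto
  then have deg: "n = degree a1" using Suc(2) by (simp add: a1 degree_mult_eq del: mult_pCons_left)
  have "poly (D * c) x = 0" using Suc.prems(3) x by (metis dvdE mult_zero_left poly_mult)
  then have "poly D x = 0" using Suc.prems(2)[OF x] by simp
  then obtain D1 where D1: "D = [:- x, 1:] * D1" by (auto simp: poly_eq_0_iff_dvd)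
  have "[:- x, 1:] * a1 dvd [:- x, 1:] * (D1 * c)"
    using Suc.prems(3) unfolding a1 D1 by (simp only: mult.assoc)
  then have "a1 dvd D1 * c" by (subst (asm) dvd_mult_cancel_left) auto
  moreover have "poly c y \<noteq> 0" if "poly a1 y = 0" for y
    using Suc.prems(2)[of y] that by (simp add: a1 del: mult_pCons_left)
  ultimately have "a1 dvd D1" using Suc.hyps(1)[OF deg \<open>a1 \<noteq> 0\<close>] by blast
  then show ?case unfolding a1 D1 by (rule mult_dvd_mono[OF dvd_refl])
qed

abbreviation at0 :: "'a::comm_ring_1 poly poly \<Rightarrow> 'a poly" where
  "at0 \<equiv> map_poly (\<lambda>f. poly f 0)"

lemma rhom_at0: "rhom at0"
  by (intro rhom_map_poly rhom_poly)

lemma coeff_at0: "coeff (at0 A) n = poly (coeff A n) 0"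
  by (simp add: coeff_map_poly)

lemma at0_eq_0:
  fixes B :: "'a::field poly poly"
  assumes "at0 B = 0"
  obtains D where "B = smult [:0, 1:] D"
proof -
  have "[:0, 1:] dvd coeff B n" for n
    using assms poly_eq_0_iff_dvd[of "coeff B n" 0] by (metis coeff_0 coeff_at0 minus_zero)
  then have "[:[:0, 1:]:] dvd B" by (simp add: const_poly_dvd_iff)
  then show ?thesis using that by (auto elim!: dvdE)
qed

lemma monic_at0:
  fixes A :: "'a::comm_ring_1 poly poly"
  assumes "lead_coeff A = 1"
  shows "degree (at0 A) = degree A" "lead_coeff (at0 A) = 1"
proof -
  show 1: "degree (at0 A) = degree A"
    using assms by (intro antisym le_degree degree_le) (simp_all add: coeff_at0 coeff_eq_0)
  show "lead_coeff (at0 A) = 1" using assms unfolding 1 by (simp add: coeff_at0)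
qed

text \<open>The last hypothesis expresses that A and C are coprime modulo x.\<close>

lemma hensel_unique:
  fixes A A' C C' :: "'a::field poly poly"
  assumes eq: "A * C = A' * C'"
    and A: "lead_coeff A = 1" "lead_coeff A' = 1" "degree A' = degree A" "at0 A = at0 A'"
    and C: "at0 C = at0 C'"
    and cop: "\<And>D. at0 A dvd D * at0 C \<Longrightarrow> at0 A dvd D"
  shows "A' = A"
proof -
  let ?x = "[:0, 1::'a:]"
  have ind: "\<exists>D E. A' = A + smult (?x ^ Suc k) D \<and> C' = C + smult (?x ^ Suc k) E" for k
  proof (induction k)
    case 0
    obtain D where "A' - A = smult ?x D"
      using at0_eq_0[of "A' - A"] A rhom_diff[OF rhom_at0] by (metis cancel_comm_monoid_add_class.diff_cancel)
    moreover obtain E where "C' - C = smult ?x E"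
      using at0_eq_0[of "C' - C"] C rhom_diff[OF rhom_at0] by (metis cancel_comm_monoid_add_class.diff_cancel)
    ultimately have "A' = A + smult (?x ^ Suc 0) D \<and> C' = C + smult (?x ^ Suc 0) E"
      by (simp add: algebra_simps)
    then show ?case by blast
  next
    case (Suc k)
    let ?m = "?x ^ Suc k"
    obtain D E where DE: "A' = A + smult ?m D" "C' = C + smult ?m E" using Suc by blast
    have "smult ?m (A * E + D * C + smult ?m (D * E)) = A' * C' - A * C"
      unfolding DE by (simp add: algebra_simps smult_add_right del: power_Suc)
    then have "A * E + D * C + smult ?m (D * E) = 0" using eq by simp
    then have "at0 (A * E + D * C + smult ?m (D * E)) = 0" by simp
    moreover have "at0 (smult ?m (D * E)) = 0"
      by (rule poly_eqI) (simp add: coeff_at0)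
    ultimately have z: "at0 A * at0 E + at0 D * at0 C = 0"
      by (simp add: rhom_simps[OF rhom_at0])
    then have "at0 D * at0 C = at0 A * (- at0 E)" by (simp add: add_eq_0_iff)
    then have "at0 A dvd at0 D * at0 C" by (rule dvdI)
    then have dv: "at0 A dvd at0 D" by (rule cop)
    have D0: "at0 D = 0"
    proof (rule ccontr)
      assume nz: "at0 D \<noteq> 0"
      then have le: "degree A \<le> degree (at0 D)" using dvd_imp_degree_le[OF dv nz] monic_at0 A by metis
      have "coeff A' i = coeff A i" if "degree A \<le> i" for i
        using that A by (cases "i = degree A") (auto simp: coeff_eq_0)
      then have "coeff A' (degree (at0 D)) = coeff A (degree (at0 D))" using le by blast
      then have "coeff D (degree (at0 D)) = 0" unfolding DE by simp
      then have "lead_coeff (at0 D) = 0" by (subst coeff_at0) simp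
      then show False using nz by simp
    qed
    moreover have "at0 A \<noteq> 0" using monic_at0[OF A(1)] by auto
    ultimately have E0: "at0 E = 0" using z by simp
    obtain D1 E1 where "D = smult ?x D1" "E = smult ?x E1" using at0_eq_0 D0 E0 by metis
    then have "A' = A + smult (?x ^ Suc (Suc k)) D1 \<and> C' = C + smult (?x ^ Suc (Suc k)) E1"
      using DE by (simp add: mult.commute)
    then show ?case by blast
  qed
  have "coeff A' n = coeff A n" for n
  proof (rule ccontr)
    assume ne: "coeff A' n \<noteq> coeff A n"
    let ?d = "coeff A' n - coeff A n"
    obtain D where "A' = A + smult (?x ^ Suc (degree ?d)) D" using ind by blast
    then have d: "?d = ?x ^ Suc (degree ?d) * coeff D n" by (metis add_diff_cancel_left' coeff_add coeff_smult)
    then have "?x ^ Suc (degree ?d) dvd ?d" by (metis dvd_triv_left)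
    then have "degree (?x ^ Suc (degree ?d)) \<le> degree ?d" using ne by (intro dvd_imp_degree_le) auto
    moreover have "degree (?x ^ Suc (degree ?d)) = Suc (degree ?d)"
      by (subst degree_power_eq) (simp_all del: power_Suc)
    ultimately show False by linarith
  qed
  then show ?thesis by (rule poly_eqI)
qed

lemma translation_invariant_imp_pcompose:
  fixes n p :: "'a::idom poly"
  assumes V: "finite V" "card V = degree n" and n: "lead_coeff n = 1" "degree n > 0"
    and root: "\<And>v. v \<in> V \<Longrightarrow> poly n v = 0"
    and n_inv: "\<And>v. v \<in> V \<Longrightarrow> pcompose n [:v, 1:] = n"
    and "\<And>v. v \<in> V \<Longrightarrow> pcompose p [:v, 1:] = p"
  shows "\<exists>s. p = pcompose s n"
  using assms(7)
proof (induction "degree p" arbitrary: p rule: less_induct)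
  case less
  define r where "r = p - [:poly p 0:]"
  have r: "poly r v = 0" if "v \<in> V" for v
    using arg_cong[OF less.prems[OF that], of "\<lambda>p. poly p 0"] by (simp add: poly_pcompose r_def)
  obtain u w where uw: "pseudo_divmod r n = (u, w)" by fastforce
  have "n \<noteq> 0" using n by auto
  then have ru: "r = n * u + w" and w: "w = 0 \<or> degree w < degree n"
    using pseudo_divmod[OF _ uw] n(1) by auto
  have "w = 0"
  proof (rule ccontr)
    assume "w \<noteq> 0"
    have "V \<subseteq> {x. poly w x = 0}" using r root ru by auto
    then have "card V \<le> card {x. poly w x = 0}" by (intro card_mono poly_roots_finite \<open>w \<noteq> 0\<close>)
    also have "\<dots> \<le> degree w" by (rule card_poly_roots_bound[OF \<open>w \<noteq> 0\<close>])
    finally show False using w V \<open>w \<noteq> 0\<close> by simp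
  qed
  then have p: "p = [:poly p 0:] + n * u" using ru by (simp add: r_def algebra_simps)
  show ?case
  proof (cases "u = 0")
    case True
    then have "p = [:poly p 0:]" using p by (metis add_0_right mult_zero_right)
    then have "p = pcompose [:poly p 0:] n" by (metis pcompose_const)
    then show ?thesis by blast
  next
    case False
    have "degree (n * u) = degree n + degree u" using \<open>n \<noteq> 0\<close> False by (rule degree_mult_eq)
    then have "degree p = degree n + degree u"
      by (subst p, subst degree_add_eq_right) (use n(2) in auto)
    moreover have "pcompose u [:v, 1:] = u" if "v \<in> V" for v
    proof -
      have "n * u = p - [:poly p 0:]" using p by (simp add: algebra_simps)
      then have "pcompose (n * u) [:v, 1:] = n * u" using less.prems[OF that] by (simp add: pcompose_diff)
      then show ?thesis using n_inv[OF that] \<open>n \<noteq> 0\<close> by (simp add: pcompose_mult)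
    qed
    ultimately obtain s where "u = pcompose s n" using less.hyps[of u] n(2) by auto
    then have "p = pcompose (pCons (poly p 0) s) n" using p by (simp add: pcompose_pCons)
    then show ?thesis by blast
  qed
qed

lemma card_roots_separable:
  fixes f :: "'a::field poly"
  assumes closed: "\<forall>f::'a poly. degree f > 0 \<longrightarrow> (\<exists>x. poly f x = 0)"
    and "f \<noteq> 0" "\<And>x. poly f x = 0 \<Longrightarrow> poly (pderiv f) x \<noteq> 0"
  shows "card {x. poly f x = 0} = degree f"
  using assms(2-)
proof (induction "degree f" arbitrary: f)
  case 0
  then obtain a where "f = [:a:]" by (metis degree_eq_zeroE)
  then show ?case using 0 by simp
next
  case (Suc n)
  obtain a where a: "poly f a = 0" using closed Suc(2) by (metis zero_less_Suc)
  then obtain g where g: "f = [:- a, 1:] * g" by (auto simp: poly_eq_0_iff_dvd)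
  have "g \<noteq> 0" using g Suc by auto
  then have deg: "n = degree g" using Suc(2) by (simp add: g degree_mult_eq del: mult_pCons_left)
  have d: "poly (pderiv f) x = (x - a) * poly (pderiv g) x + poly g x" for x
    unfolding g pderiv_mult by (simp add: pderiv_pCons algebra_simps del: mult_pCons_left)
  have "poly g a \<noteq> 0" using Suc.prems(2)[OF a] d by simp
  have "card {x. poly g x = 0} = degree g"
  proof (rule Suc.hyps(1)[OF deg \<open>g \<noteq> 0\<close>])
    fix x assume x: "poly g x = 0"
    then have "poly f x = 0" by (simp add: g del: mult_pCons_left)
    from Suc.prems(2)[OF this] show "poly (pderiv g) x \<noteq> 0" using d x by auto
  qed
  moreover have "{x. poly f x = 0} = insert a {x. poly g x = 0}" by (auto simp: g)
  moreover have "finite {x. poly g x = 0}" by (rule poly_roots_finite[OF \<open>g \<noteq> 0\<close>])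
  ultimately show ?case using \<open>poly g a \<noteq> 0\<close> deg Suc(2) by simp
qed

context frobenius_idom
begin

lemma degree_orbN:
  fixes X Y :: 'a
  shows "degree (orbN q [:X:] [:Y:] [:0, 1:]) = q\<^sup>2" "lead_coeff (orbN q [:X:] [:Y:] [:0, 1:]) = 1"
proof -
  let ?n = "orbN q [:X:] [:Y:] [:0, 1:]"
  have "q * 1 < q * q" using q2 by (intro mult_strict_left_mono) auto
  then have "q < q\<^sup>2" by (simp add: power2_eq_square)
  then have qq: "q < q\<^sup>2" "1 < q\<^sup>2" using q2 by linarith+
  have "?n = monom 1 (q\<^sup>2) - smult (dickQ q X Y) (monom 1 q) + smult (dickL q X Y ^ (q - 1)) (monom 1 1)"
    by (simp add: orbN_def monom_altdef flip: rhom_dickQ[OF rhom_const] rhom_dickL[OF rhom_const] poly_const_pow)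
  then have c: "coeff ?n i = (if i = q\<^sup>2 then 1 else 0) - dickQ q X Y * (if i = q then 1 else 0)
      + dickL q X Y ^ (q - 1) * (if i = 1 then 1 else 0)" for i
    using qq q2 by (auto simp: coeff_monom)
  show d: "degree ?n = q\<^sup>2"
    using qq q2 by (intro antisym degree_le le_degree) (auto simp: c)
  show "lead_coeff ?n = 1" using qq q2 unfolding d by (simp add: c)
qed

lemma degree_orbF:
  fixes X Y :: 'a
  shows "degree (orbF q [:X:] [:Y:] [:0, 1:]) = q\<^sup>2 * (q - 1)" "lead_coeff (orbF q [:X:] [:Y:] [:0, 1:]) = 1"
proof -
  let ?n = "orbN q [:X:] [:Y:] [:0, 1:]"
  have F: "orbF q [:X:] [:Y:] [:0, 1:] = ?n ^ (q - 1) + [:dickQ q X Y ^ q:]"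
    by (simp add: orbF_def poly_const_pow flip: rhom_dickQ[OF rhom_const])
  have nz: "?n \<noteq> 0" using degree_orbN(2)[of X Y] by auto
  have d: "degree (?n ^ (q - 1)) = q\<^sup>2 * (q - 1)"
    using degree_orbN(1)[of X Y] nz by (simp add: degree_power_eq)
  have lt: "degree [:dickQ q X Y ^ q:] < degree (?n ^ (q - 1))" unfolding d using q2 by simp
  show "degree (orbF q [:X:] [:Y:] [:0, 1:]) = q\<^sup>2 * (q - 1)"
    unfolding F using degree_add_eq_left[OF lt] d by simp
  show "lead_coeff (orbF q [:X:] [:Y:] [:0, 1:]) = 1"
    unfolding F using lead_coeff_add_le[OF lt] degree_orbN(2)[of X Y] by (simp add: lead_coeff_power add.commute)
qed

lemma pcompose_orbN_translation:
  fixes X Y :: 'a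
  assumes "dickL q X Y \<noteq> 0" "e ^ q = e" "f ^ q = f"
  shows "pcompose (orbN q [:X:] [:Y:] [:0, 1:]) [:e * X + f * Y, 1:] = orbN q [:X:] [:Y:] [:0, 1:]"
proof -
  interpret P: frobenius_idom p m q "TYPE('a poly)" by (rule frobenius_idom_poly)
  let ?v = "e * X + f * Y"
  have "pcompose (orbN q [:X:] [:Y:] [:0, 1:]) [:?v, 1:] = orbN q [:X:] [:Y:] ([:?v:] + [:0, 1:])"
    by (simp add: rhom_orbN[OF rhom_pcompose] pcompose_pCons)
  also have "\<dots> = [:orbN q X Y ?v:] + orbN q [:X:] [:Y:] [:0, 1:]"
    by (simp only: P.orbN_add rhom_orbN[OF rhom_const])
  finally show ?thesis using orbN_translation[OF assms] by simp
qed

lemma inj_translations: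
  fixes X Y :: 'a
  assumes L: "dickL q X Y \<noteq> 0" and "u ^ q = u" "v ^ q = v" "u * X + v * Y = 0"
  shows "u = 0 \<and> v = 0"
proof -
  have uX: "u * X = - (v * Y)" using assms(4) by (simp add: eq_neg_iff_add_eq_0)
  have "u * X ^ q = (u * X) ^ q" using assms by (simp add: power_mult_distrib)
  also have "\<dots> = - (v * Y ^ q)" unfolding uX frob_minus using assms by (simp add: power_mult_distrib)
  finally have uXq: "u * X ^ q = - (v * Y ^ q)" .
  have "u * dickL q X Y = (u * X) * Y ^ q - (u * X ^ q) * Y" by (simp add: dickL_def algebra_simps)
  also have "\<dots> = 0" unfolding uX uXq by simp
  finally have u: "u = 0" using L by simp
  have "v * dickL q X Y = X * (v * Y ^ q) - X ^ q * (v * Y)" by (simp add: dickL_def algebra_simps)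
  moreover have "v * Y = 0" "v * Y ^ q = 0" using uX uXq u by auto
  ultimately have "v = 0" using L by simp
  then show ?thesis using u by simp
qed

lemma invariant_imp_pcompose_orbN:
  fixes X Y :: 'a
  assumes L: "dickL q X Y \<noteq> 0" and S: "card S = q" "\<And>e. e \<in> S \<Longrightarrow> e ^ q = e"
    and inv: "\<And>e f. e \<in> S \<Longrightarrow> f \<in> S \<Longrightarrow> pcompose A [:e * X + f * Y, 1:] = A"
  shows "\<exists>s. A = pcompose s (orbN q [:X:] [:Y:] [:0, 1:])"
proof -
  let ?V = "(\<lambda>(e, f). e * X + f * Y) ` (S \<times> S)"
  have finS: "finite S" using S(1) q2 by (metis card.infinite not_numeral_le_zero)
  have "inj_on (\<lambda>(e, f). e * X + f * Y) (S \<times> S)"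
  proof (rule inj_onI, clarify)
    fix e f e' f' assume s: "e \<in> S" "f \<in> S" "e' \<in> S" "f' \<in> S" and eq: "e * X + f * Y = e' * X + f' * Y"
    have "(e - e') * X + (f - f') * Y = 0" using eq by (simp add: algebra_simps)
    moreover have "(e - e') ^ q = e - e'" "(f - f') ^ q = f - f'" using s S(2) by (simp_all add: frob_diff)
    ultimately show "e = e' \<and> f = f'" using inj_translations[OF L] by fastforce
  qed
  then have cV: "card ?V = q\<^sup>2" using S(1) by (simp add: card_image card_cartesian_product power2_eq_square)
  show ?thesis
  proof (rule translation_invariant_imp_pcompose[of ?V])
    show "finite ?V" using finS by simp
    show "card ?V = degree (orbN q [:X:] [:Y:] [:0, 1:])" by (simp add: cV degree_orbN)
    show "0 < degree (orbN q [:X:] [:Y:] [:0, 1:])" using q2 by (simp add: degree_orbN)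
    show "lead_coeff (orbN q [:X:] [:Y:] [:0, 1:]) = 1" by (rule degree_orbN)
    show "poly (orbN q [:X:] [:Y:] [:0, 1:]) v = 0" if "v \<in> ?V" for v
      using that S(2) orbN_translation[OF L] by (auto simp: rhom_orbN[OF rhom_poly])
    show "pcompose (orbN q [:X:] [:Y:] [:0, 1:]) [:v, 1:] = orbN q [:X:] [:Y:] [:0, 1:]" if "v \<in> ?V" for v
      using that S(2) pcompose_orbN_translation[OF L] by auto
    show "pcompose A [:v, 1:] = A" if "v \<in> ?V" for v using that inv by auto
  qed
qed

end

context frobenius_ring
begin

lemma of_nat_q_diff_1: "of_nat (q - 1) = (-1 :: 'a)"
  using q0 q2 by (simp add: of_nat_diff)

lemma orbF_expansion:
  fixes X Z :: 'a
  shows "\<exists>V. orbF q X 1 Z = ((Z ^ q - Z) ^ (q - 1) + 1) ^ q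
      + X ^ (q - 1) * ((Z ^ q - Z) ^ ((q - 1) * (q - 1)) + X ^ (q - 1) * V)"
proof -
  define y W where "y = X ^ (q - 1)" and "W = Z ^ q - Z"
  define R where "R = (\<Sum>i\<le>q - 2. y ^ i)"
  have q: "q = Suc (Suc (q - 2))" using q2 by simp
  have Q: "dickQ q X 1 = 1 + y + y\<^sup>2 * R"
  proof -
    have "dickQ q X 1 = (\<Sum>i\<le>Suc (Suc (q - 2)). y ^ i)"
      using q by (simp add: dickQ_def y_def power_mult)
    also have "\<dots> = 1 + y + y\<^sup>2 * R"
      unfolding sum.atMost_Suc_shift R_def
      by (simp add: sum_distrib_left power2_eq_square mult.assoc)
    finally show ?thesis .
  qed
  have qy: "Suc (q - 1) = q" using q2 by simp
  then have "X ^ q = X * y" by (metis power_Suc y_def)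
  then have L: "dickL q X 1 = X * (1 + - y)" by (simp add: dickL_def algebra_simps)
  obtain U where "(1 + - y) ^ (q - 1) = 1 ^ (q - 1) + of_nat (q - 1) * 1 ^ (q - 1 - 1) * (- y) + (- y)\<^sup>2 * U"
    using binomial_mod_square by blast
  then have "(1 + - y) ^ (q - 1) = 1 + y + y\<^sup>2 * U"
    unfolding of_nat_q_diff_1 by simp
  then have Lq: "dickL q X 1 ^ (q - 1) = y * (1 + y + y\<^sup>2 * U)"
    unfolding L power_mult_distrib y_def by (simp only:)
  define T where "T = (1 + y * U) * Z - R * Z ^ q"
  have n: "orbN q X 1 Z = W ^ q + y * (y * T - W)"
  proof -
    have "Z ^ q\<^sup>2 = (Z ^ q) ^ q" by (simp add: power2_eq_square power_mult)
    moreover have "W ^ q = (Z ^ q) ^ q - Z ^ q" by (simp add: W_def frob_diff)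
    ultimately have "Z ^ q\<^sup>2 = W ^ q + Z ^ q" by simp
    then show ?thesis
      unfolding orbN_def Q Lq T_def W_def by (simp add: power2_eq_square algebra_simps)
  qed
  obtain N where N: "orbN q X 1 Z ^ (q - 1) = (W ^ q) ^ (q - 1) + of_nat (q - 1) * (W ^ q) ^ (q - 1 - 1) * (y * (y * T - W))
      + (y * (y * T - W))\<^sup>2 * N"
    unfolding n using binomial_mod_square by blast
  have W1: "(W ^ q) ^ (q - 1 - 1) * W = W ^ ((q - 1) * (q - 1))"
  proof -
    obtain k where "q = Suc (Suc k)" using q by blast
    then have "Suc (q * (q - 1 - 1)) = (q - 1) * (q - 1)" by simp
    then show ?thesis by (metis power_Suc2 power_mult)
  qed
  have "dickQ q X 1 ^ q = 1 + y\<^sup>2 * (y ^ (q - 2) + (y * R) ^ q * y ^ (q - 2))"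
  proof -
    have "y ^ q = y\<^sup>2 * y ^ (q - 2)" by (subst q) (simp add: power2_eq_square mult.assoc)
    moreover have "dickQ q X 1 ^ q = 1 + y ^ q + (y * (y * R)) ^ q"
      unfolding Q by (simp add: frob power2_eq_square mult.assoc)
    ultimately show ?thesis by (simp add: power_mult_distrib[of y "y * R"] algebra_simps)
  qed
  moreover have "(W ^ (q - 1) + 1) ^ q = (W ^ q) ^ (q - 1) + 1"
    by (simp add: frob mult.commute flip: power_mult)
  ultimately have "orbF q X 1 Z = (W ^ (q - 1) + 1) ^ q + y * (W ^ ((q - 1) * (q - 1))
      + y * ((y ^ (q - 2) + (y * R) ^ q * y ^ (q - 2)) - (W ^ q) ^ (q - 1 - 1) * T + (y * T - W)\<^sup>2 * N))"
    unfolding orbF_def N of_nat_q_diff_1 W1[symmetric] by (simp add: power2_eq_square algebra_simps)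
  then show ?thesis unfolding y_def W_def by blast
qed

end

section \<open>Irreducibility of the dehomogenized form\<close>

lemma map_poly_pcompose:
  assumes h: "rhom h"
  shows "map_poly h (pcompose A B) = pcompose (map_poly h A) (map_poly h B)"
  by (induction A) (simp_all add: pcompose_pCons map_poly_pCons rhom_0[OF h] rhom_simps[OF rhom_map_poly[OF h]])

lemma monic_pcompose_linear:
  fixes A :: "'a::idom poly"
  assumes "lead_coeff A = 1"
  shows "degree (pcompose A [:v, 1:]) = degree A" "lead_coeff (pcompose A [:v, 1:]) = 1"
  using assms lead_coeff_comp[of "[:v, 1:]" A] by (simp_all add: degree_pcompose)

lemma degree_monic_factor_of_monom:
  fixes a c :: "'a::idom poly"
  assumes prod: "a * c = monom 1 k" and "coeff a 0 \<noteq> 0"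
  shows "degree a = 0"
proof -
  have nz: "a * c \<noteq> 0" unfolding prod by simp
  have "order 0 (a * c) = k" unfolding prod by simp
  moreover have "order 0 a = 0" using assms(2) by (intro order_0I) (simp add: poly_0_coeff_0)
  ultimately have "order 0 c = k" using order_mult[OF nz, of 0] by simp
  then have "k \<le> degree c" using order_degree[of c 0] nz by auto
  moreover have "degree a + degree c = k"
  proof -
    have "degree (a * c) = k" unfolding prod by (simp add: degree_monom_eq)
    moreover have "a \<noteq> 0" "c \<noteq> 0" using nz by auto
    ultimately show ?thesis by (simp add: degree_mult_eq)
  qed
  ultimately show ?thesis by simp
qed

locale closed_frobenius = frobenius_idom p m q ty for p m q and ty :: "'a::field itself" +
  assumes closed: "\<forall>f::'a poly. degree f > 0 \<longrightarrow> (\<exists>x. poly f x = 0)"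
begin

lemma card_Fq: "card {c::'a. c ^ q = c} = q"
proof -
  let ?f = "monom 1 q - [:0, 1::'a:]"
  have deg: "degree ?f = q"
    using q2 by (intro antisym degree_le le_degree) (auto simp: coeff_pCons split: nat.splits)
  then have "?f \<noteq> 0" using q2 by (metis degree_0 not_numeral_le_zero)
  have root: "poly ?f x = 0 \<longleftrightarrow> x ^ q = x" for x by (simp add: poly_monom)
  have "pderiv ?f = - 1"
    by (simp add: pderiv_diff pderiv_monom q0 pderiv_pCons one_pCons)
  then have "card {x. poly ?f x = 0} = degree ?f"
    using \<open>?f \<noteq> 0\<close> by (intro card_roots_separable[OF closed]) auto
  then show ?thesis by (simp only: root deg)
qed

abbreviation "xx \<equiv> [:[:0, 1::'a:]:]"
abbreviation "zz \<equiv> [:0, 1::'a poly:]"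
abbreviation "ff \<equiv> orbF q xx 1 zz"
abbreviation "nn \<equiv> orbN q xx 1 zz"

lemma ff_nn_monic:
  "degree ff = q\<^sup>2 * (q - 1)" "lead_coeff ff = 1" "degree nn = q\<^sup>2" "lead_coeff nn = 1"
proof -
  interpret P: frobenius_idom p m q "TYPE('a poly)" by (rule frobenius_idom_poly)
  show "degree ff = q\<^sup>2 * (q - 1)" "lead_coeff ff = 1" "degree nn = q\<^sup>2" "lead_coeff nn = 1"
    using P.degree_orbF[of "[:0,1:]" 1] P.degree_orbN[of "[:0,1:]" 1] by (simp_all flip: one_pCons)
qed

lemma dickL_x: "dickL q [:0, 1::'a:] 1 \<noteq> 0"
proof -
  have "coeff (dickL q [:0, 1::'a:] 1) 1 = 1"
    using q2 by (simp add: dickL_def flip: monom_altdef[of 1 _, simplified])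
  then show ?thesis by (metis coeff_0 zero_neq_one)
qed

lemma at0_ff: "at0 ff = (([:0, 1:] ^ q - [:0, 1:]) ^ (q - 1) + 1) ^ q"
proof -
  interpret P: frobenius_idom p m q "TYPE('a poly)" by (rule frobenius_idom_poly)
  let ?z = "[:0, 1:] :: 'a poly"
  have "at0 ff = orbF q 0 1 ?z"
    by (simp add: rhom_orbF[OF rhom_at0] map_poly_pCons)
  also obtain V where "orbF q 0 1 ?z = ((?z ^ q - ?z) ^ (q - 1) + 1) ^ q
      + 0 ^ (q - 1) * ((?z ^ q - ?z) ^ ((q - 1) * (q - 1)) + 0 ^ (q - 1) * V)"
    using P.orbF_expansion by blast
  finally show ?thesis using q2 by (simp add: power_0_left)
qed

definition eps :: "'a poly poly \<Rightarrow> 'a" where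
  "eps A = poly (poly A 0) 0"

lemma rhom_eps: "rhom eps"
  by (simp add: rhom_def eps_def)

lemma eps_coeff: "eps A = coeff (coeff A 0) 0"
  by (simp add: eps_def poly_0_coeff_0)

lemma no_common_root_at0:
  assumes AC: "A * C = ff" and root: "poly (at0 A) z0 = 0"
  shows "poly (at0 C) z0 \<noteq> 0"
proof -
  interpret P: frobenius_idom p m q "TYPE('a poly)" by (rule frobenius_idom_poly)
  interpret PP: frobenius_ring p m q "TYPE('a poly poly)" by (rule P.frobenius_ring_poly)
  let ?c = "\<lambda>c::'a. [:[:c:]:]"
  have c: "rhom ?c" by (rule rhom_comp[OF rhom_const rhom_const])
  define w0 where "w0 = z0 ^ q - z0"
  have "at0 ff = at0 A * at0 C" by (simp add: AC[symmetric] rhom_mult[OF rhom_at0])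
  then have "poly (at0 ff) z0 = 0" using root by simp
  then have w0: "w0 ^ (q - 1) = - 1"
    unfolding at0_ff by (simp add: rhom_simps[OF rhom_poly] w0_def eq_neg_iff_add_eq_0)
  then have "w0 \<noteq> 0" using q2 by (auto simp: power_0_left)
  define sh where "sh = (\<lambda>B. pcompose B [:[:z0:], 1:])"
  have sh: "rhom sh" unfolding sh_def by (rule rhom_pcompose)
  define u where "u = zz ^ q - zz"
  define Z where "Z = [:[:z0:], 1:]"
  have Z: "Z ^ q - Z = ?c w0 + u"
  proof -
    have "Z = ?c z0 + zz" by (simp add: Z_def)
    then have "Z ^ q = ?c z0 ^ q + zz ^ q" by (simp only: PP.frob)
    then show ?thesis using \<open>Z = ?c z0 + zz\<close>
      by (simp add: w0_def u_def rhom_simps[OF c] algebra_simps)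
  qed
  have "sh xx = xx" "sh 1 = 1" "sh zz = Z" by (simp_all add: sh_def pcompose_pCons pcompose_1 Z_def)
  then have "sh ff = orbF q xx 1 Z" by (simp add: rhom_orbF[OF sh])
  moreover obtain V where "orbF q xx 1 Z = ((Z ^ q - Z) ^ (q - 1) + 1) ^ q
      + xx ^ (q - 1) * ((Z ^ q - Z) ^ ((q - 1) * (q - 1)) + xx ^ (q - 1) * V)"
    using PP.orbF_expansion by blast
  moreover have k: "?c w0 ^ (q - 1) = - 1"
    by (simp only: rhom_power[OF c, symmetric] w0 rhom_uminus[OF c] rhom_1[OF c])
  moreover obtain V' where "(?c w0 + u) ^ (q - 1) = ?c w0 ^ (q - 1) + of_nat (q - 1) * ?c w0 ^ (q - 1 - 1) * u + u\<^sup>2 * V'"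
    using binomial_mod_square by blast
  then have "(?c w0 + u) ^ (q - 1) + 1 = u * (u * V' - ?c w0 ^ (q - 1 - 1))"
    unfolding PP.of_nat_q_diff_1 k by (simp add: power2_eq_square algebra_simps)
  moreover have "u = zz * (zz ^ (q - 1) - 1)"
    using q2 by (cases q) (simp_all add: u_def algebra_simps)
  ultimately have "sh ff = (zz * ((zz ^ (q - 1) - 1) * (u * V' - ?c w0 ^ (q - 1 - 1)))) ^ q
     + xx ^ (q - 1) * ((?c w0 + u) ^ ((q - 1) * (q - 1)) + xx ^ (q - 1) * V)" (is "_ = (zz * ?G) ^ q + xx ^ (q - 1) * ?H")
    by (simp only: Z mult.assoc)
  also have "\<dots> = monom 1 q * ?G ^ q + smult (monom 1 (q - 1)) ?H"
  proof -
    have "xx ^ (q - 1) = [:monom 1 (q - 1):]" by (simp add: poly_const_pow monom_altdef)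
    moreover have "[:d:] * B = smult d B" for d and B :: "'a poly poly" by simp
    ultimately have "xx ^ (q - 1) * ?H = smult (monom 1 (q - 1)) ?H" by (simp only:)
    moreover have "(zz * ?G) ^ q = monom 1 q * ?G ^ q"
      unfolding power_mult_distrib by (simp only: monom_altdef smult_1_left)
    ultimately show ?thesis by (simp only:)
  qed
  finally have prod: "sh A * sh C = monom 1 q * ?G ^ q + smult (monom 1 (q - 1)) ?H"
    by (simp add: AC[symmetric] rhom_mult[OF sh])
  have e: "eps zz = 0" "eps (?c w0) = w0" "eps xx = 0" by (simp_all add: eps_def)
  then have "eps u = 0" using q2 by (simp add: u_def rhom_simps[OF rhom_eps] power_0_left)
  then have "eps ?G = w0 ^ (q - 1 - 1)" "eps ?H = w0 ^ ((q - 1) * (q - 1))"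
    using e q2 by (simp_all add: rhom_simps[OF rhom_eps] power_0_left)
  then have "eps (?G ^ q) \<noteq> 0" "eps ?H \<noteq> 0" using \<open>w0 \<noteq> 0\<close> by (simp_all add: rhom_simps[OF rhom_eps])
  then have "coeff (coeff (sh A) 0) 0 \<noteq> 0 \<or> coeff (coeff (sh C) 0) 0 \<noteq> 0"
    using local_irreducibility[OF coprime_diff_one_right_nat _ _ prod] q2 by (simp add: eps_coeff)
  moreover have "coeff (coeff (sh B) 0) 0 = poly (at0 B) z0" for B
  proof -
    have "coeff (coeff (sh B) 0) 0 = poly (poly B [:z0:]) 0"
      by (simp add: sh_def pcompose_coeff_0 poly_0_coeff_0)
    also have "\<dots> = poly (at0 B) z0"
      by (induction B) (simp_all add: map_poly_pCons)
    finally show ?thesis .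
  qed
  ultimately show ?thesis using root by simp
qed

lemma factor_invariant_0:
  assumes AC: "A * C = ff" and lc: "lead_coeff A = 1" and e: "e ^ q = e"
  shows "pcompose A [:[:0, e:], 1:] = A"
proof -
  interpret P: frobenius_idom p m q "TYPE('a poly)" by (rule frobenius_idom_poly)
  let ?v = "[:[:0, e:], 1:]"
  have at0: "at0 (pcompose B ?v) = at0 B" for B
    by (simp add: map_poly_pcompose[OF rhom_poly] map_poly_pCons)
  have "pcompose ff ?v = orbF q xx 1 ?v"
    by (simp add: rhom_orbF[OF rhom_pcompose] pcompose_pCons pcompose_1)
  also have "\<dots> = ff"
  proof -
    have "pcompose nn [:[:e:] * [:0, 1:] + 0 * 1, 1:] = nn"
      using P.pcompose_orbN_translation[OF dickL_x, of "[:e:]" 0] e q2 by (simp add: poly_const_pow power_0_left flip: one_pCons)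
    then have "orbN q xx 1 ?v = nn"
      by (simp add: rhom_orbN[OF rhom_pcompose] pcompose_pCons pcompose_1)
    then show ?thesis by (simp add: orbF_def)
  qed
  finally have inv: "pcompose ff ?v = ff" .
  show ?thesis
  proof (rule hensel_unique)
    show "A * C = pcompose A ?v * pcompose C ?v"
      using inv by (simp add: AC flip: pcompose_mult)
    show "at0 A dvd D" if "at0 A dvd D * at0 C" for D
    proof (rule dvd_if_dvd_mult_no_common_root[OF closed _ no_common_root_at0[OF AC] that])
      show "at0 A \<noteq> 0" using monic_at0(2)[OF lc] by (metis coeff_0 zero_neq_one)
    qed
    show "lead_coeff (pcompose A ?v) = 1" by (rule monic_pcompose_linear(2)[OF lc])
  qed (simp_all only: at0 monic_pcompose_linear(1)[OF lc] lc)
qed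

lemma factor_invariant_1:
  assumes AC: "A * C = ff" and lc: "lead_coeff A = 1" and e: "e ^ q = e"
  shows "pcompose A [:[:- e, e:], 1:] = A"
proof -
  interpret P: frobenius_idom p m q "TYPE('a poly)" by (rule frobenius_idom_poly)
  interpret PP: frobenius_idom p m q "TYPE('a poly poly)" by (rule P.frobenius_idom_poly)
  define sg where "sg = (\<lambda>c::'a. map_poly (\<lambda>g. pcompose g [:c, 1:]))"
  have sg: "rhom (sg c)" for c unfolding sg_def by (intro rhom_map_poly rhom_pcompose)
  have deg: "degree (sg c B) = degree B" for c B
    unfolding sg_def by (intro degree_map_poly) (simp add: pcompose_eq_0_iff)
  have lcs: "lead_coeff (sg c B) = 1" if "lead_coeff B = 1" for c B
    using that unfolding deg by (simp add: sg_def coeff_map_poly pcompose_1)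
  have inverse: "sg (- c) (sg c B) = B" for c B
    by (rule poly_eqI) (simp add: sg_def coeff_map_poly pcompose_assoc[symmetric] pcompose_pCons)
  have L: "dickL q xx 1 \<noteq> 0"
  proof -
    have "dickL q xx 1 = [:dickL q [:0, 1::'a:] 1:]" by (simp only: rhom_dickL[OF rhom_const] one_pCons)
    then show ?thesis using dickL_x by (simp only: pCons_eq_0_iff simp_thms)
  qed
  have "sg 1 ff = orbF q (1 * xx + 1 * 1) (0 * xx + 1 * 1) (0 * xx + 0 * 1 + 1 * zz)"
    by (simp add: rhom_orbF[OF sg]) (simp add: sg_def map_poly_pCons pcompose_pCons one_pCons)
  also have "\<dots> = ff" using q2 by (intro PP.orbF_linear L) (simp_all add: power_0_left)
  finally have "sg 1 A * sg 1 C = ff" by (simp flip: AC rhom_mult[OF sg])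
  then have "pcompose (sg 1 A) [:[:0, e:], 1:] = sg 1 A"
    using factor_invariant_0 lcs[OF lc] e by blast
  then have "sg (- 1) (pcompose (sg 1 A) [:[:0, e:], 1:]) = A" using inverse by simp
  then have "pcompose A (sg (- 1) [:[:0, e:], 1:]) = A"
    using map_poly_pcompose[OF rhom_pcompose, of _ "sg 1 A" "[:[:0, e:], 1:]"] inverse[of 1 A] by (simp add: sg_def)
  then show ?thesis by (simp add: sg_def map_poly_pCons pcompose_pCons pcompose_1)
qed

lemma factor_invariant:
  assumes AC: "A * C = ff" and lc: "lead_coeff A = 1" and ef: "e ^ q = e" "f ^ q = f"
  shows "pcompose A [:[:f, e:], 1:] = A"
proof -
  have "pcompose (pcompose A [:[:0, e + f:], 1:]) [:[:- (- f), - f:], 1:] = A"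
    using factor_invariant_0[OF AC lc, of "e + f"] factor_invariant_1[OF AC lc, of "- f"] ef
    by (simp add: frob frob_minus)
  then show ?thesis by (simp add: pcompose_assoc[symmetric] pcompose_pCons)
qed

lemma factor_eq_pcompose_nn:
  assumes AC: "A * C = ff" and lc: "lead_coeff A = 1"
  shows "\<exists>s. A = pcompose s nn"
proof -
  interpret P: frobenius_idom p m q "TYPE('a poly)" by (rule frobenius_idom_poly)
  have "\<exists>s. A = pcompose s (orbN q [:[:0,1:]:] [:1:] [:0, 1:])"
  proof (rule P.invariant_imp_pcompose_orbN[OF dickL_x])
    show "card ((\<lambda>c. [:c:]) ` {c::'a. c ^ q = c}) = q"
      by (subst card_image) (auto simp: card_Fq inj_on_def)
    show "e ^ q = e" if "e \<in> (\<lambda>c. [:c:]) ` {c::'a. c ^ q = c}" for e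
      using that by (auto simp: poly_const_pow)
    show "pcompose A [:e * [:0, 1:] + f * 1, 1:] = A"
      if "e \<in> (\<lambda>c. [:c:]) ` {c::'a. c ^ q = c}" "f \<in> (\<lambda>c. [:c:]) ` {c::'a. c ^ q = c}" for e f
      using that factor_invariant[OF AC lc] by auto
  qed
  then show ?thesis by (simp flip: one_pCons)
qed

lemma dickQ_simple_root:
  obtains \<rho> R where "dickQ q [:0, 1::'a:] 1 = [:- \<rho>, 1:] * R" "poly R \<rho> \<noteq> 0"
proof -
  let ?x = "[:0, 1::'a:]"
  have QL: "dickQ q ?x 1 * dickL q ?x 1 = ?x - ?x ^ q\<^sup>2"
    using dickQ_mult_dickL[of q ?x 1] q2 by simp
  have L: "dickL q ?x 1 = ?x - ?x ^ q" by (simp add: dickL_def)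
  have deg: "degree (?x - ?x ^ k) = k" "?x - ?x ^ k \<noteq> 0" if "k \<ge> 2" for k
  proof -
    have c: "coeff (?x - ?x ^ k) i = (if i = 1 then 1 else 0) - (if i = k then 1 else 0)" for i
      by (simp add: coeff_pCons flip: monom_altdef[of 1 _, simplified] split: nat.splits)
    then show "degree (?x - ?x ^ k) = k"
      using that by (intro antisym degree_le le_degree) (auto simp: c)
    then show "?x - ?x ^ k \<noteq> 0" using that by (metis degree_0 not_numeral_le_zero)
  qed
  have "q * 1 < q * q" using q2 by (intro mult_strict_left_mono) auto
  then have "q < q\<^sup>2" by (simp add: power2_eq_square)
  then have qq: "q < q\<^sup>2" "2 \<le> q\<^sup>2" using q2 by linarith+
  have "dickQ q ?x 1 \<noteq> 0" using QL deg(2)[OF qq(2)] by auto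
  then have "degree (?x - ?x ^ q\<^sup>2) = degree (dickQ q ?x 1) + degree (?x - ?x ^ q)"
    unfolding QL[symmetric] L[symmetric] by (rule degree_mult_eq) (rule dickL_x)
  then have "degree (dickQ q ?x 1) + q = q\<^sup>2"
    unfolding deg(1)[OF q2] deg(1)[OF qq(2)] by simp
  then have "degree (dickQ q ?x 1) > 0" using qq by linarith
  then obtain \<rho> where "poly (dickQ q ?x 1) \<rho> = 0" using closed by blast
  then obtain R where R: "dickQ q ?x 1 = [:- \<rho>, 1:] * R" by (auto simp: poly_eq_0_iff_dvd)
  have "poly R \<rho> \<noteq> 0"
  proof
    assume z: "poly R \<rho> = 0"
    have "of_nat (q\<^sup>2) = (0::'a)" by (simp add: q0)
    then have "pderiv (?x - ?x ^ q\<^sup>2) = 1"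
      by (simp add: pderiv_diff pderiv_power pderiv_pCons one_pCons)
    then have "pderiv ([:- \<rho>, 1:] * (R * dickL q ?x 1)) = 1"
      unfolding QL[symmetric] R by (simp only: mult.assoc)
    then have "poly (pderiv ([:- \<rho>, 1:] * (R * dickL q ?x 1))) \<rho> = 1" by simp
    then show False using z by (simp add: pderiv_mult pderiv_pCons del: mult_pCons_left)
  qed
  then show ?thesis using that R by blast
qed

lemma ff_factor_trivial:
  assumes AC: "A * C = ff" and lc: "lead_coeff A = 1" "lead_coeff C = 1"
  shows "degree A = 0 \<or> degree C = 0"
proof -
  interpret P: frobenius_idom p m q "TYPE('a poly)" by (rule frobenius_idom_poly)
  have nn0: "degree nn > 0" using q2 by (simp add: ff_nn_monic)
  obtain \<alpha> where \<alpha>: "A = pcompose \<alpha> nn" using factor_eq_pcompose_nn[OF AC lc(1)] by blast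
  have "C * A = ff" using AC by (simp add: mult.commute)
  then obtain \<gamma> where \<gamma>: "C = pcompose \<gamma> nn" using factor_eq_pcompose_nn[OF _ lc(2)] by blast
  have lc': "lead_coeff \<alpha> = 1" "lead_coeff \<gamma> = 1"
    using lc lead_coeff_comp[OF nn0, of \<alpha>] lead_coeff_comp[OF nn0, of \<gamma>] ff_nn_monic(4)
    by (simp_all add: \<alpha> \<gamma>)
  let ?Q = "dickQ q [:0, 1::'a:] 1"
  have "[:?Q ^ q:] = dickQ q xx 1 ^ q"
    by (simp only: rhom_dickQ[OF rhom_const] rhom_power[OF rhom_const] one_pCons)
  then have ff: "ff = nn ^ (q - 1) + [:?Q ^ q:]" by (simp only: orbF_def)
  have pc: "pcompose (\<alpha> * \<gamma> - (monom 1 (q - 1) + [:?Q ^ q:])) nn = A * C - ff"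
    by (simp add: \<alpha> \<gamma> ff pcompose_diff pcompose_mult pcompose_add monom_altdef pcompose_pCons pcompose_1
        rhom_power[OF rhom_pcompose])
  have "\<alpha> * \<gamma> - (monom 1 (q - 1) + [:?Q ^ q:]) = 0"
    by (rule pcompose_eq_0[OF _ nn0]) (simp only: pc AC diff_self)
  then have prod: "\<alpha> * \<gamma> = monom 1 (q - 1) + [:?Q ^ q:]" by simp
  obtain \<rho> R where R: "?Q = [:- \<rho>, 1:] * R" "poly R \<rho> \<noteq> 0" using dickQ_simple_root by blast
  define \<tau> where "\<tau> = map_poly (\<lambda>g. pcompose g [:\<rho>, 1::'a:])"
  have \<tau>: "rhom \<tau>" unfolding \<tau>_def by (intro rhom_map_poly rhom_pcompose)
  have degt: "degree (\<tau> B) = degree B" for B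
    unfolding \<tau>_def by (intro degree_map_poly) (simp add: pcompose_eq_0_iff)
  have lct: "lead_coeff (\<tau> B) = 1" if "lead_coeff B = 1" for B
    using that unfolding degt by (simp add: \<tau>_def coeff_map_poly pcompose_1)
  let ?R = "pcompose R [:\<rho>, 1:]"
  have "pcompose (?Q ^ q) [:\<rho>, 1:] = ([:0, 1:] * ?R) ^ q"
    unfolding R by (simp add: rhom_power[OF rhom_pcompose] pcompose_mult pcompose_pCons del: mult_pCons_left)
  also have "\<dots> = monom 1 q * ?R ^ q" by (simp add: power_mult_distrib monom_altdef del: mult_pCons_left)
  finally have "\<tau> \<alpha> * \<tau> \<gamma> = monom 1 (q - 1) + [:monom 1 q * ?R ^ q:]"
    using arg_cong[OF prod, of \<tau>]
    by (simp add: rhom_simps[OF \<tau>]) (simp add: \<tau>_def map_poly_monom map_poly_pCons pcompose_1)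
  then have prod': "\<tau> \<alpha> * \<tau> \<gamma> = monom 1 (q - 1) * 1 + smult (monom 1 q) [:?R ^ q:]" by simp
  have "coeff (?R ^ q) 0 = poly R \<rho> ^ q"
    by (simp add: poly_pcompose flip: poly_0_coeff_0)
  then have "coeff (coeff (\<tau> \<alpha>) 0) 0 \<noteq> 0 \<or> coeff (coeff (\<tau> \<gamma>) 0) 0 \<noteq> 0"
    using local_irreducibility[OF coprime_diff_one_left_nat _ _ prod'] q2 R(2) by simp
  moreover have prod0: "at0 (\<tau> \<alpha>) * at0 (\<tau> \<gamma>) = monom 1 (q - 1)"
    using q2 unfolding rhom_mult[OF rhom_at0, symmetric] prod'
    by (intro poly_eqI) (simp add: coeff_at0 poly_monom power_0_left coeff_pCons split: nat.splits)
  have "degree B = 0" if "lead_coeff B = 1" "coeff (coeff (\<tau> B) 0) 0 \<noteq> 0" "at0 (\<tau> B) * D = monom 1 (q - 1)" for B D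
  proof -
    have "coeff (at0 (\<tau> B)) 0 \<noteq> 0" unfolding coeff_at0 using that(2) by (simp add: poly_0_coeff_0)
    from degree_monic_factor_of_monom[OF that(3) this]
    show ?thesis unfolding monic_at0(1)[OF lct[OF that(1)]] degt .
  qed
  ultimately have "degree \<alpha> = 0 \<or> degree \<gamma> = 0"
    using prod0 lc' by (metis mult.commute)
  then show ?thesis by (auto simp: \<alpha> \<gamma> degree_pcompose)
qed

end

section \<open>Ternary forms and linear substitutions\<close>

lemma rhom_const3: "rhom const3"
  by (simp add: rhom_def const3_def one_pCons)

lemma rhom_subst3: "rhom (\<lambda>F. subst3 F u v w)"
  unfolding subst3_def by (intro rhom_eval_map rhom_const3)

lemma subst3_const3: "subst3 (const3 c) u v w = const3 c"
  and subst3_varX: "subst3 varX u v w = u"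
  and subst3_varY: "subst3 varY u v w = v"
  and subst3_varZ: "subst3 varZ u v w = w"
  by (simp_all add: subst3_def const3_def[of c] varX_def varY_def varZ_def map_poly_pCons
      rhom_simps[OF rhom_const3] map_poly_1')

lemmas subst3_simps = rhom_simps[OF rhom_subst3] subst3_const3 subst3_varX subst3_varY subst3_varZ

lemma form3_rhom_eqI:
  fixes F :: "'k::comm_ring_1 form3"
  assumes g: "rhom g" and h: "rhom h" and c: "\<And>c. g (const3 c) = h (const3 c)"
    and X: "g varX = h varX" and Y: "g varY = h varY" and Z: "g varZ = h varZ"
  shows "g F = h F"
proof -
  have 1: "g [:[:f:]:] = h [:[:f:]:]" for f
  proof (induction f)
    case 0
    show ?case by (simp add: rhom_0[OF g] rhom_0[OF h])
  next
    case (pCons a f)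
    have "[:[:pCons a f:]:] = const3 a + varX * [:[:f:]:]" by (simp add: const3_def varX_def)
    then show ?case using pCons by (simp only: rhom_simps[OF g] rhom_simps[OF h] c X)
  qed
  have 2: "g [:f:] = h [:f:]" for f
  proof (induction f)
    case 0
    show ?case by (simp add: rhom_0[OF g] rhom_0[OF h])
  next
    case (pCons a f)
    have "[:pCons a f:] = [:[:a:]:] + varY * [:f:]" by (simp add: varY_def)
    then show ?case using pCons by (simp only: rhom_simps[OF g] rhom_simps[OF h] 1 Y)
  qed
  show ?thesis
  proof (induction F)
    case 0
    show ?case by (simp add: rhom_0[OF g] rhom_0[OF h])
  next
    case (pCons a f)
    have "pCons a f = [:a:] + varZ * f" by (simp add: varZ_def)
    then show ?case using pCons by (simp only: rhom_simps[OF g] rhom_simps[OF h] 2 Z)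
  qed
qed

lemma rhom_act3: "rhom (act3 A)"
  unfolding act3_def by (rule rhom_subst3)

lemma act3_const3: "act3 A (const3 c) = const3 c"
  by (simp add: act3_def subst3_const3)

lemma act3_vars: "act3 A varX = lin_form (A $ 1)" "act3 A varY = lin_form (A $ 2)" "act3 A varZ = lin_form (A $ 3)"
  by (simp_all add: act3_def subst3_simps)

lemma act3_lin_form: "act3 A (lin_form (B $ i)) = lin_form ((B ** A) $ i)"
  by (simp add: lin_form_def[of "B $ i"] rhom_simps[OF rhom_act3] act3_const3 act3_vars)
     (simp add: lin_form_def matrix_matrix_mult_def sum_3 rhom_simps[OF rhom_const3] algebra_simps)

lemma act3_act3: "act3 A (act3 B F) = act3 (B ** A) F"
  by (rule form3_rhom_eqI[where g = "\<lambda>F. act3 A (act3 B F)" and h = "act3 (B ** A)"])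
     (simp_all add: rhom_comp[OF rhom_act3 rhom_act3] rhom_act3 act3_const3 act3_vars act3_lin_form)

lemma act3_mat_1: "act3 (mat 1) F = F"
proof (rule form3_rhom_eqI[where g = "act3 (mat 1)" and h = "\<lambda>F. F"])
  show "rhom (\<lambda>F::'a form3. F)" by (simp add: rhom_def)
qed (simp_all add: rhom_act3 act3_const3 act3_vars, simp_all add: lin_form_def mat_def rhom_simps[OF rhom_const3])

lemma irreducible_rhom_image:
  assumes g: "rhom g" and h: "rhom h" and inv: "\<And>x. g (h x) = x" "\<And>x. h (g x) = x" and F: "irreducible F"
  shows "irreducible (g F)"
proof (rule irreducibleI)
  show "g F \<noteq> 0" using F inv(2)[of F] rhom_0[OF h] by (metis not_irreducible_zero)
  show "\<not> g F dvd 1" using F rhom_dvd[OF h, of "g F" 1] inv rhom_1[OF h] by (metis irreducible_not_unit)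
  fix a b assume "g F = a * b"
  then have "F = h a * h b" by (metis inv(2) rhom_mult[OF h])
  then have "h a dvd 1 \<or> h b dvd 1" by (rule irreducibleD[OF F])
  then show "a dvd 1 \<or> b dvd 1" using rhom_dvd[OF g] inv(1) rhom_1[OF g] by metis
qed

definition form_deg :: "'k::zero form3 \<Rightarrow> nat \<Rightarrow> bool" where
  "form_deg F d \<longleftrightarrow> (\<forall>i j k. coeff3 F i j k \<noteq> 0 \<longrightarrow> i + j + k = d)"

lemma homogeneous3_iff: "homogeneous3 F d \<longleftrightarrow> F \<noteq> 0 \<and> form_deg F d"
  by (simp add: homogeneous3_def form_deg_def)

lemma form_deg_0: "form_deg 0 d"
  by (simp add: form_deg_def coeff3_def)

lemma form_deg_add: "form_deg F d \<Longrightarrow> form_deg G d \<Longrightarrow> form_deg (F + G) d"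
  unfolding form_deg_def coeff3_def by (metis add.right_neutral coeff_add)

lemma form_deg_diff:
  fixes F G :: "'k::comm_ring_1 form3"
  shows "form_deg F d \<Longrightarrow> form_deg G d \<Longrightarrow> form_deg (F - G) d"
  by (simp add: form_deg_def coeff3_def) metis

lemma form_deg_sum: "(\<And>i. i \<in> A \<Longrightarrow> form_deg (f i) d) \<Longrightarrow> form_deg (sum f A) d"
  by (induction A rule: infinite_finite_induct) (simp_all add: form_deg_0 form_deg_add)

lemma form_deg_mult:
  fixes F G :: "'k::comm_ring_1 form3"
  assumes "form_deg F a" "form_deg G b"
  shows "form_deg (F * G) (a + b)"
  unfolding form_deg_def
proof (intro allI impI)
  fix i j k assume "coeff3 (F * G) i j k \<noteq> 0"
  then have "(\<Sum>l\<le>k. coeff (coeff (coeff F l * coeff G (k - l)) j) i) \<noteq> 0"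
    by (simp add: coeff3_def coeff_mult[of F G] coeff_sum)
  then obtain l where l: "l \<le> k" "coeff (coeff (coeff F l * coeff G (k - l)) j) i \<noteq> 0"
    using sum.not_neutral_contains_not_neutral by (metis (no_types, lifting) atMost_iff)
  obtain j' i' where "j' \<le> j" "i' \<le> i" "coeff3 F i' j' l \<noteq> 0" "coeff3 G (i - i') (j - j') (k - l) \<noteq> 0"
    using coeff2_mult_nonzero[OF l(2)] unfolding coeff3_def by metis
  then have "i' + j' + l = a" "(i - i') + (j - j') + (k - l) = b"
    using assms unfolding form_deg_def by blast+
  then show "i + j + k = a + b" using \<open>j' \<le> j\<close> \<open>i' \<le> i\<close> l(1) by linarith
qed

lemma form_deg_const3: "form_deg (const3 c) 0"
  by (auto simp: form_deg_def coeff3_def const3_def coeff_pCons split: nat.splits if_splits)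

lemma form_deg_vars: "form_deg varX 1" "form_deg varY 1" "form_deg varZ 1"
  by (auto simp: form_deg_def coeff3_def varX_def varY_def varZ_def coeff_pCons split: nat.splits if_splits)

lemma form_deg_power:
  fixes F :: "'k::comm_ring_1 form3"
  assumes "form_deg F a"
  shows "form_deg (F ^ n) (a * n)"
proof (induction n)
  case 0
  then show ?case using form_deg_const3[of 1] by (simp add: rhom_1[OF rhom_const3])
next
  case (Suc n)
  then show ?case using form_deg_mult[OF assms] by simp
qed

lemma form_deg_lin_form: "form_deg (lin_form r) 1"
proof -
  have mult: "form_deg (const3 c * v) 1" if "form_deg v 1" for c and v :: "'a form3"
    using form_deg_mult[OF form_deg_const3 that] by simp
  then show ?thesis unfolding lin_form_def by (intro form_deg_add mult form_deg_vars)
qed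

lemma form_deg_eval_map:
  fixes h :: "'b::comm_ring_1 \<Rightarrow> 'k::comm_ring_1 form3"
  assumes h: "rhom h" and w: "form_deg w 1"
    and "\<And>i. coeff p i \<noteq> 0 \<Longrightarrow> i \<le> e \<and> form_deg (h (coeff p i)) (e - i)"
  shows "form_deg (poly (map_poly h p) w) e"
proof -
  have "poly (map_poly h p) w = (\<Sum>i\<le>degree (map_poly h p). h (coeff p i) * w ^ i)"
    by (simp add: poly_altdef coeff_map_poly rhom_0[OF h])
  moreover have "form_deg (h (coeff p i) * w ^ i) e" for i
  proof (cases "coeff p i = 0")
    case True
    then show ?thesis by (simp add: rhom_0[OF h] form_deg_0)
  next
    case False
    then have "i \<le> e" "form_deg (h (coeff p i)) (e - i)" using assms(3) by auto
    then show ?thesis using form_deg_mult[OF _ form_deg_power[OF w], of "h (coeff p i)" "e - i" i] by simp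
  qed
  ultimately show ?thesis by (simp add: form_deg_sum)
qed

lemma form_deg_act3:
  fixes F :: "'k::comm_ring_1 form3"
  assumes F: "form_deg F d"
  shows "form_deg (act3 A F) d"
proof -
  have coe: "i + j + k = d" if "coeff (coeff (coeff F k) j) i \<noteq> 0" for i j k
    using that F by (simp add: form_deg_def coeff3_def)
  have 1: "form_deg (poly (map_poly const3 (coeff (coeff F k) j)) u) (d - k - j)" if "form_deg u 1" for k j u
    by (rule form_deg_eval_map[OF rhom_const3 that]) (use coe[of k j] form_deg_const3 in fastforce)
  have 2: "form_deg (poly (map_poly (\<lambda>f. poly (map_poly const3 f) u) (coeff F k)) v) (d - k)"
    if "form_deg u 1" "form_deg v 1" for k u v
  proof (rule form_deg_eval_map[OF rhom_eval_map[OF rhom_const3] that(2)], intro conjI 1[OF that(1)])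
    fix j assume "coeff (coeff F k) j \<noteq> 0"
    then obtain i where "coeff (coeff (coeff F k) j) i \<noteq> 0" by (metis leading_coeff_0_iff)
    from coe[OF this] show "j \<le> d - k" by linarith
  qed
  show ?thesis unfolding act3_def subst3_def
  proof (rule form_deg_eval_map[OF rhom_eval_map[OF rhom_eval_map[OF rhom_const3]] form_deg_lin_form], intro conjI 2 form_deg_lin_form)
    fix k assume "coeff F k \<noteq> 0"
    then obtain j where "coeff (coeff F k) j \<noteq> 0" by (metis leading_coeff_0_iff)
    then obtain i where "coeff (coeff (coeff F k) j) i \<noteq> 0" by (metis leading_coeff_0_iff)
    from coe[OF this] show "k \<le> d" by linarith
  qed
qed

lemma form_deg_dick:
  "form_deg (dickQ q varX varY) ((q - 1) * q)" "form_deg (dickL q varX varY) (q + 1)"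
proof -
  show "form_deg (dickQ q varX varY) ((q - 1) * q)"
    unfolding dickQ_def
  proof (rule form_deg_sum)
    fix i assume "i \<in> {..q}"
    then have "1 * ((q - 1) * i) + 1 * ((q - 1) * (q - i)) = (q - 1) * q" by (simp flip: distrib_left)
    then show "form_deg (varX ^ ((q - 1) * i) * varY ^ ((q - 1) * (q - i))) ((q - 1) * q)"
      using form_deg_mult[OF form_deg_power[OF form_deg_vars(1)] form_deg_power[OF form_deg_vars(2)], of "(q - 1) * i" "(q - 1) * (q - i)"]
      by metis
  qed
  show "form_deg (dickL q varX varY) (q + 1)"
    unfolding dickL_def
    using form_deg_mult[OF form_deg_vars(1) form_deg_power[OF form_deg_vars(2), of q]]
      form_deg_mult[OF form_deg_power[OF form_deg_vars(1), of q] form_deg_vars(2)]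
    by (intro form_deg_diff) (simp_all add: add.commute)
qed

lemma form_deg_orbF:
  assumes "q \<ge> 2"
  shows "form_deg (orbF q varX varY varZ) (q ^ 3 - q ^ 2)"
proof -
  obtain n where n: "q = Suc n" using assms by (cases q) auto
  have e: "(q - 1) * q + 1 * q = q\<^sup>2" "(q + 1) * (q - 1) + 1 = q\<^sup>2" "1 * q\<^sup>2 = q\<^sup>2"
     "q\<^sup>2 * (q - 1) = q ^ 3 - q ^ 2" "(q - 1) * q * q = q ^ 3 - q ^ 2"
    by (simp_all add: n power2_eq_square power3_eq_cube algebra_simps)
  have "form_deg (orbN q varX varY varZ) (q\<^sup>2)"
    unfolding orbN_def
    using form_deg_power[OF form_deg_vars(3), of "q\<^sup>2"]
      form_deg_mult[OF form_deg_dick(1)[of q] form_deg_power[OF form_deg_vars(3), of q]]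
      form_deg_mult[OF form_deg_power[OF form_deg_dick(2)[of q], of "q - 1"] form_deg_vars(3)]
    unfolding e by (intro form_deg_add form_deg_diff)
  from form_deg_power[OF this, of "q - 1"] form_deg_power[OF form_deg_dick(1), of q q]
  show ?thesis unfolding orbF_def e by (rule form_deg_add)
qed

lemma unit_form3:
  fixes F :: "'k::field form3"
  assumes "F dvd 1"
  obtains c where "F = const3 c"
proof -
  obtain g where g: "F = [:g:]" "g dvd 1" using assms by (auto simp: is_unit_poly_iff)
  obtain h where h: "g = [:h:]" "h dvd 1" using g(2) by (auto simp: is_unit_poly_iff)
  obtain c where c: "h = [:c:]" "c dvd 1" using h(2) by (auto simp: is_unit_poly_iff)
  show ?thesis using that[of c] g h c by (simp add: const3_def)
qed

lemma linear_factor_degree: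
  fixes F :: "'k::field form3"
  assumes "homogeneous3 F d" "irreducible F" "form_deg l 1" "l dvd F"
  shows "d = 1"
proof -
  obtain G where G: "F = l * G" using assms(4) by (auto elim: dvdE)
  have uniq: "a = b" if H: "form_deg H a" "form_deg H b" "H \<noteq> 0" for H :: "'k form3" and a b
  proof -
    obtain i j k where "coeff3 H i j k \<noteq> 0" using H(3) unfolding coeff3_def by (metis leading_coeff_0_iff)
    then show ?thesis using H unfolding form_deg_def by metis
  qed
  have nz: "F \<noteq> 0" and F: "form_deg F d" using assms(1) by (simp_all add: homogeneous3_iff)
  have "\<not> l dvd 1"
  proof
    assume "l dvd 1"
    then obtain c where "l = const3 c" by (rule unit_form3)
    then show False using uniq[OF assms(3), of 0] form_deg_const3[of c] nz G by auto
  qed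
  then have "G dvd 1" using irreducibleD[OF assms(2) G] by blast
  then obtain c where "G = const3 c" by (rule unit_form3)
  then have "form_deg F 1" using form_deg_mult[OF assms(3) form_deg_const3, of c] G by simp
  then show ?thesis using uniq[OF F] nz by blast
qed

section \<open>Invariant curves\<close>

lemma binary_form_linear_factor:
  fixes g :: "'k::field poly poly"
  assumes closed: "\<forall>f::'k poly. degree f > 0 \<longrightarrow> (\<exists>x. poly f x = 0)"
    and g: "g \<noteq> 0" and hom: "\<And>i j. coeff (coeff g j) i \<noteq> 0 \<Longrightarrow> i + j = d" and "d > 0"
  shows "[:[:0, 1:]:] dvd g \<or> (\<exists>\<rho>. [:- [:0, \<rho>:], 1:] dvd g)"
proof (cases "degree g = 0")
  case True
  then obtain h where h: "g = [:h:]" by (auto elim: degree_eq_zeroE)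
  have "coeff h 0 = 0" using hom[of 0 0] \<open>d > 0\<close> h by auto
  then have "[:0, 1:] dvd h" using poly_eq_0_iff_dvd[of h 0] by (simp add: poly_0_coeff_0)
  then have "[:[:0, 1:]:] dvd g" unfolding h by (auto elim!: dvdE)
  then show ?thesis ..
next
  case False
  define a where "a j = coeff (coeff g j) (d - j)" for j
  have co: "coeff g j = monom (a j) (d - j)" for j
  proof (rule poly_eqI)
    show "coeff (coeff g j) i = coeff (monom (a j) (d - j)) i" for i
      using hom[of j i] by (cases "coeff (coeff g j) i = 0") (auto simp: a_def)
  qed
  have le: "a j = 0 \<or> j \<le> d" for j using hom[of j "d - j"] unfolding a_def by fastforce
  define f where "f = map_poly (\<lambda>h. poly h 1) g"
  have cf: "coeff f j = a j" for j by (simp add: f_def coeff_map_poly co poly_monom)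
  have "a (degree g) \<noteq> 0" using g co[of "degree g"] by (metis leading_coeff_0_iff monom_eq_0)
  then have "degree g \<le> degree f" by (intro le_degree) (simp add: cf)
  then obtain \<rho> where \<rho>: "poly f \<rho> = 0" using False closed by fastforce
  have degf: "degree f \<le> degree g" by (intro degree_le) (simp add: cf a_def coeff_eq_0)
  have "poly g [:0, \<rho>:] = (\<Sum>j\<le>degree g. monom (a j * \<rho> ^ j) d)"
    unfolding poly_altdef
  proof (rule sum.cong[OF refl])
    fix j
    have "[:0, \<rho>:] ^ j = monom (\<rho> ^ j) j"
      by (induction j) (simp_all add: monom_0 monom_Suc one_pCons smult_monom)
    then show "coeff g j * [:0, \<rho>:] ^ j = monom (a j * \<rho> ^ j) d"
      using le[of j] by (auto simp: co mult_monom)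
  qed
  also have "\<dots> = monom (\<Sum>j\<le>degree g. a j * \<rho> ^ j) d"
    by (rule poly_eqI) (simp add: coeff_sum sum.If_cases)
  also have "(\<Sum>j\<le>degree g. a j * \<rho> ^ j) = poly f \<rho>"
    unfolding poly_altdef cf[symmetric]
    by (rule sum.mono_neutral_right) (use degf in \<open>auto simp: coeff_eq_0\<close>)
  finally have "poly g [:0, \<rho>:] = 0" using \<rho> by simp
  then show ?thesis by (auto simp: poly_eq_0_iff_dvd)
qed

definition FqM :: "nat \<Rightarrow> ('k::field ^3^3) set" where
  "FqM q = {A. \<forall>i j. A $ i $ j \<in> Fq q}"

context closed_frobenius
begin

lemma Fq_closed:
  fixes a b :: 'a
  shows "0 \<in> Fq q" "1 \<in> Fq q" "a \<in> Fq q \<Longrightarrow> b \<in> Fq q \<Longrightarrow> a + b \<in> Fq q"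
    "a \<in> Fq q \<Longrightarrow> b \<in> Fq q \<Longrightarrow> a * b \<in> Fq q" "a \<in> Fq q \<Longrightarrow> - a \<in> Fq q"
    "a \<in> Fq q \<Longrightarrow> b \<in> Fq q \<Longrightarrow> a / b \<in> Fq q"
  using q2 by (simp_all add: Fq_def frob frob_minus power_mult_distrib power_divide power_0_left)

lemma FqM_mult: "A \<in> FqM q \<Longrightarrow> B \<in> FqM q \<Longrightarrow> A ** (B :: 'a^3^3) \<in> FqM q"
  by (simp add: FqM_def matrix_matrix_mult_def sum_3 Fq_closed)

lemma inv_curve_degrees_conj:
  fixes B B' :: "'a^3^3"
  assumes B: "B \<in> FqM q" "B' \<in> FqM q" and inv: "B ** B' = mat 1" "B' ** B = mat 1"
  shows "inv_curve_degrees (stab_AGL q (B *v P)) \<subseteq> inv_curve_degrees (stab_AGL q P)"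
proof
  fix d assume "d \<in> inv_curve_degrees (stab_AGL q (B *v P))"
  then obtain F :: "'a form3" where d: "d \<noteq> 1" and hom: "homogeneous3 F d" and irr: "irreducible F"
    and F: "invariant_curve (stab_AGL q (B *v P)) F"
    unfolding inv_curve_degrees_def by blast
  let ?G = "act3 B F"
  have irrG: "irreducible ?G"
    by (rule irreducible_rhom_image[OF rhom_act3 rhom_act3[of B']]) (simp_all add: act3_act3 inv act3_mat_1 irr)
  then have "homogeneous3 ?G d"
    using hom form_deg_act3 unfolding homogeneous3_iff by (metis not_irreducible_zero)
  moreover have "invariant_curve (stab_AGL q P) ?G"
    unfolding invariant_curve_def
  proof
    fix A assume A: "A \<in> stab_AGL q P"
    then obtain l where l: "A *v P = l *s P" by (auto simp: stab_AGL_def)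
    let ?A = "B ** A ** B'"
    have "det B * det B' = 1" using inv(1) by (metis det_I det_mul)
    then have "det ?A \<noteq> 0" using A by (auto simp: det_mul stab_AGL_def)
    moreover have "A \<in> FqM q" using A by (simp add: FqM_def stab_AGL_def)
    then have "?A \<in> FqM q" by (intro FqM_mult B)
    moreover have "?A *v (B *v P) = l *s (B *v P)"
    proof -
      have "?A *v (B *v P) = (B ** A ** (B' ** B)) *v P" by (simp add: matrix_vector_mul_assoc matrix_mul_assoc)
      also have "\<dots> = B *v (A *v P)" by (simp add: inv matrix_vector_mul_assoc)
      finally show ?thesis by (simp add: l vector_scalar_commute)
    qed
    ultimately have "?A \<in> stab_AGL q (B *v P)" by (auto simp: stab_AGL_def FqM_def)
    then obtain c where c: "c \<noteq> 0" "act3 ?A F = const3 c * F" using F by (auto simp: invariant_curve_def)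
    have "act3 A ?G = act3 (?A ** B) F"
      by (simp add: act3_act3 inv flip: matrix_mul_assoc)
    also have "\<dots> = act3 B (const3 c * F)" by (simp add: c(2)[symmetric] act3_act3)
    also have "\<dots> = const3 c * ?G" by (simp add: rhom_mult[OF rhom_act3] act3_const3)
    finally show "\<exists>c. c \<noteq> 0 \<and> act3 A ?G = const3 c * ?G" using c(1) by blast
  qed
  ultimately show "d \<in> inv_curve_degrees (stab_AGL q P)"
    using irrG d by (auto simp: inv_curve_degrees_def)
qed

lemma exists_frame:
  fixes P :: "'a^3"
  assumes "P \<noteq> 0" "\<forall>i. P $ i \<in> Fq q"
  shows "\<exists>B B'. B \<in> FqM q \<and> B' \<in> FqM q \<and> B ** B' = mat 1 \<and> B' ** B = mat 1 \<and> B *v axis 3 1 = P"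
proof -
  let ?p1 = "P $ 1" and ?p2 = "P $ 2" and ?p3 = "P $ 3"
  have P: "?p1 \<in> Fq q" "?p2 \<in> Fq q" "?p3 \<in> Fq q" using assms(2) by auto
  note simps = FqM_def forall_3 vector_3 Fq_closed P vec_eq_iff matrix_matrix_mult_def sum_3 mat_def
    matrix_vector_mult_def axis_def field_simps
  have "?p1 \<noteq> 0 \<or> ?p2 \<noteq> 0 \<or> ?p3 \<noteq> 0" using assms(1) by (auto simp: vec_eq_iff forall_3)
  then consider "?p3 \<noteq> 0" | "?p2 \<noteq> 0" | "?p1 \<noteq> 0" by blast
  then show ?thesis
  proof cases
    case 1
    let ?B = "vector [vector [1, 0, ?p1], vector [0, 1, ?p2], vector [0, 0, ?p3]] :: 'a^3^3"
    let ?B' = "vector [vector [1, 0, - (?p1 / ?p3)], vector [0, 1, - (?p2 / ?p3)], vector [0, 0, 1 / ?p3]] :: 'a^3^3"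
    have "?B \<in> FqM q" "?B' \<in> FqM q" by (simp_all add: FqM_def forall_3 vector_3 Fq_closed P)
    moreover have "?B ** ?B' = mat 1" "?B' ** ?B = mat 1" "?B *v axis 3 1 = P" using 1 by (simp_all add: simps)
    ultimately show ?thesis by blast
  next
    case 2
    let ?B = "vector [vector [1, 0, ?p1], vector [0, 0, ?p2], vector [0, 1, ?p3]] :: 'a^3^3"
    let ?B' = "vector [vector [1, - (?p1 / ?p2), 0], vector [0, - (?p3 / ?p2), 1], vector [0, 1 / ?p2, 0]] :: 'a^3^3"
    have "?B \<in> FqM q" "?B' \<in> FqM q" by (simp_all add: FqM_def forall_3 vector_3 Fq_closed P)
    moreover have "?B ** ?B' = mat 1" "?B' ** ?B = mat 1" "?B *v axis 3 1 = P" using 2 by (simp_all add: simps)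
    ultimately show ?thesis by blast
  next
    case 3
    let ?B = "vector [vector [0, 0, ?p1], vector [1, 0, ?p2], vector [0, 1, ?p3]] :: 'a^3^3"
    let ?B' = "vector [vector [- (?p2 / ?p1), 1, 0], vector [- (?p3 / ?p1), 0, 1], vector [1 / ?p1, 0, 0]] :: 'a^3^3"
    have "?B \<in> FqM q" "?B' \<in> FqM q" by (simp_all add: FqM_def forall_3 vector_3 Fq_closed P)
    moreover have "?B ** ?B' = mat 1" "?B' ** ?B = mat 1" "?B *v axis 3 1 = P" using 3 by (simp_all add: simps)
    ultimately show ?thesis by blast
  qed
qed

lemma stab_axis_3:
  "A \<in> stab_AGL q (axis 3 1 :: 'a^3) \<longleftrightarrow> A \<in> FqM q \<and> det A \<noteq> 0 \<and> A $ 1 $ 3 = 0 \<and> A $ 2 $ 3 = 0"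
proof -
  have "(\<exists>l. A *v axis 3 1 = l *s axis 3 (1::'a)) \<longleftrightarrow> A $ 1 $ 3 = 0 \<and> A $ 2 $ 3 = 0"
    by (auto simp: vec_eq_iff forall_3 matrix_vector_mult_def sum_3 axis_def)
  then show ?thesis by (auto simp: stab_AGL_def FqM_def)
qed

abbreviation "XX \<equiv> [:[:0, 1::'a:]:]"
abbreviation "YY \<equiv> [:0, 1::'a poly:]"

lemma vars_conv: "(varX :: 'a form3) = [:XX:]" "(varY :: 'a form3) = [:YY:]" "(varZ :: 'a form3) = [:0, 1:]"
  by (simp_all add: varX_def varY_def varZ_def)

lemma dickL_XY: "dickL q XX YY \<noteq> 0"
proof
  assume "dickL q XX YY = 0"
  then have "poly (dickL q XX YY) 1 = 0" by simp
  then have "dickL q (poly XX 1) (poly YY 1) = 0" by (simp only: rhom_dickL[OF rhom_poly])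
  then show False using dickL_x by simp
qed

lemma orbF_irreducible: "irreducible (orbF q varX varY (varZ :: 'a form3))"
proof -
  interpret P: frobenius_idom p m q "TYPE('a poly)" by (rule frobenius_idom_poly)
  interpret PP: frobenius_idom p m q "TYPE('a poly poly)" by (rule P.frobenius_idom_poly)
  let ?F = "orbF q varX varY (varZ :: 'a form3)"
  have deg: "degree ?F > 0" and lcF: "lead_coeff ?F = 1"
    using q2 PP.degree_orbF[of XX YY] unfolding vars_conv by auto
  define \<delta> :: "'a form3 \<Rightarrow> 'a poly poly" where "\<delta> = map_poly (\<lambda>g. poly g 1)"
  have \<delta>: "rhom \<delta>" unfolding \<delta>_def by (intro rhom_map_poly rhom_poly)
  have \<delta>F: "\<delta> ?F = ff"
    by (simp add: rhom_orbF[OF \<delta>]) (simp add: vars_conv \<delta>_def map_poly_pCons one_pCons)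
  show ?thesis
  proof (rule irreducibleI)
    show "?F \<noteq> 0" using deg by auto
    show "\<not> ?F dvd 1" using deg by (metis degree_1 dvd_imp_degree_le le_zero_eq less_irrefl one_neq_zero)
    fix A C assume AC: "?F = A * C"
    define a c where "a = lead_coeff A" and "c = lead_coeff C"
    have ac: "a * c = 1" using lcF unfolding AC lead_coeff_mult a_def c_def .
    then have "poly a 1 * poly c 1 = 1" by (metis poly_1 poly_mult)
    then have nz: "poly a 1 \<noteq> 0" "poly c 1 \<noteq> 0" by auto
    have lA: "lead_coeff (\<delta> A) = poly a 1" "lead_coeff (\<delta> C) = poly c 1"
      using nz unfolding \<delta>_def a_def c_def by (simp_all add: lead_coeff_map_poly_nz)
    have "degree (\<delta> B) = degree B" if "poly (lead_coeff B) 1 \<noteq> 0" for B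
      unfolding \<delta>_def using that by (intro antisym degree_le le_degree) (simp_all add: coeff_map_poly coeff_eq_0)
    then have dA: "degree (\<delta> A) = degree A" "degree (\<delta> C) = degree C"
      using nz unfolding a_def c_def by blast+
    have "smult (poly c 1) (\<delta> A) * smult (poly a 1) (\<delta> C) = smult (poly a 1 * poly c 1) (\<delta> (A * C))"
      by (simp add: rhom_mult[OF \<delta>] mult.commute)
    also have "\<dots> = ff" using \<open>poly a 1 * poly c 1 = 1\<close> \<delta>F unfolding AC by simp
    finally have "degree (smult (poly c 1) (\<delta> A)) = 0 \<or> degree (smult (poly a 1) (\<delta> C)) = 0"
      using \<open>poly a 1 * poly c 1 = 1\<close> by (intro ff_factor_trivial) (simp_all only: lead_coeff_smult lA mult.commute)
    then have "degree A = 0 \<or> degree C = 0" using nz dA by simp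
    moreover have "B dvd 1" if "degree B = 0" "lead_coeff B * e = 1" for B :: "'a form3" and e
    proof -
      obtain b where b: "B = [:b:]" using \<open>degree B = 0\<close> by (auto elim: degree_eq_zeroE)
      then have "1 = B * [:e:]" using that(2) by (simp add: one_pCons mult.commute)
      then show ?thesis by (rule dvdI)
    qed
    ultimately show "A dvd 1 \<or> C dvd 1" using ac unfolding a_def c_def by (metis mult.commute)
  qed
qed

lemma orbF_invariant: "invariant_curve (stab_AGL q (axis 3 1 :: 'a^3)) (orbF q varX varY varZ)"
  unfolding invariant_curve_def
proof
  fix A assume "A \<in> stab_AGL q (axis 3 1 :: 'a^3)"
  then have A: "A \<in> FqM q" "det A \<noteq> 0" "A $ 1 $ 3 = 0" "A $ 2 $ 3 = 0" by (simp_all add: stab_axis_3)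
  interpret P: frobenius_idom p m q "TYPE('a poly)" by (rule frobenius_idom_poly)
  interpret PP: frobenius_idom p m q "TYPE('a poly poly)" by (rule P.frobenius_idom_poly)
  interpret PPP: frobenius_idom p m q "TYPE('a form3)" by (rule PP.frobenius_idom_poly)
  have fx: "const3 (A $ i $ j) ^ q = const3 (A $ i $ j)" for i j
    using A(1) by (simp add: FqM_def Fq_def flip: rhom_power[OF rhom_const3])
  have inj: "const3 c \<noteq> 0" if "c \<noteq> 0" for c :: 'a using that by (simp add: const3_def)
  have "det A = (A $ 1 $ 1 * A $ 2 $ 2 - A $ 1 $ 2 * A $ 2 $ 1) * A $ 3 $ 3"
    using A(3,4) by (simp add: det_3 algebra_simps)
  then have nz: "A $ 1 $ 1 * A $ 2 $ 2 - A $ 1 $ 2 * A $ 2 $ 1 \<noteq> 0" "A $ 3 $ 3 \<noteq> 0" using A(2) by auto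
  have L: "dickL q varX varY \<noteq> (0 :: 'a form3)"
    unfolding vars_conv using dickL_XY by (simp flip: rhom_dickL[OF rhom_const])
  have "act3 A (orbF q varX varY varZ) = orbF q varX varY varZ"
    unfolding rhom_orbF[OF rhom_act3] act3_vars lin_form_def A(3,4) rhom_0[OF rhom_const3] mult_zero_left add_0_right
  proof (rule PPP.orbF_linear[OF L])
    show "const3 (A $ 1 $ 1) * const3 (A $ 2 $ 2) - const3 (A $ 1 $ 2) * const3 (A $ 2 $ 1) \<noteq> 0"
      using inj[OF nz(1)] by (simp add: rhom_simps[OF rhom_const3])
  qed (simp_all add: fx inj nz)
  then show "\<exists>c. c \<noteq> 0 \<and> act3 A (orbF q varX varY varZ) = const3 c * orbF q varX varY varZ"
    by (intro exI[of _ 1]) (simp add: rhom_1[OF rhom_const3])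
qed

lemma Fq_exponent_dvd:
  assumes "\<And>l::'a. l ^ q = l \<Longrightarrow> l \<noteq> 0 \<Longrightarrow> l ^ n = 1"
  shows "(q - 1) dvd n"
proof (rule ccontr)
  assume "\<not> (q - 1) dvd n"
  define r where "r = n mod (q - 1)"
  have r: "r > 0" "r < q - 1" using \<open>\<not> (q - 1) dvd n\<close> q2 by (auto simp: r_def dvd_eq_mod_eq_0)
  let ?f = "monom 1 r - 1 :: 'a poly"
  have deg: "degree ?f = r"
    using r by (intro antisym degree_le le_degree) auto
  then have nz: "?f \<noteq> 0" using r by auto
  have "l ^ r = 1" if "l ^ q = l" "l \<noteq> 0" for l :: 'a
  proof -
    have "l * l ^ (q - 1) = l * 1" using that(1) q2 by (cases q) auto
    then have "l ^ (q - 1) = 1" using that(2) by simp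
    then have "l ^ n = l ^ r"
      by (metis div_mult_mod_eq r_def power_add power_mult mult.commute power_one mult_1)
    then show ?thesis using assms[OF that] by simp
  qed
  then have "{l::'a. l ^ q = l} - {0} \<subseteq> {l. poly ?f l = 0}" by (auto simp: poly_monom)
  then have "card ({l::'a. l ^ q = l} - {0}) \<le> card {l. poly ?f l = 0}"
    by (intro card_mono poly_roots_finite nz)
  also have "\<dots> \<le> r" using card_poly_roots_bound[OF nz] deg by simp
  finally show False using card_Fq q2 r by (subst (asm) card_Diff_singleton) (auto simp: power_0_left)
qed

lemma invariant_curve_degree_ge:
  fixes F :: "'a form3"
  assumes hom: "homogeneous3 F d" and irr: "irreducible F" and "d \<noteq> 1"
    and inv: "invariant_curve (stab_AGL q (axis 3 1 :: 'a^3)) F"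
  shows "q ^ 3 - q ^ 2 \<le> d"
proof -
  interpret P: frobenius_idom p m q "TYPE('a poly)" by (rule frobenius_idom_poly)
  interpret PP: frobenius_idom p m q "TYPE('a poly poly)" by (rule P.frobenius_idom_poly)
  let ?c = "\<lambda>c::'a. [:[:c:]:]"
  have c: "rhom ?c" by (rule rhom_comp[OF rhom_const rhom_const])
  have "F \<noteq> 0" and deg: "form_deg F d" using hom by (auto simp: homogeneous3_iff)
  have nodvd: "\<not> l dvd F" if "form_deg l 1" for l
    using linear_factor_degree[OF hom irr that] \<open>d \<noteq> 1\<close> by blast
  have act: "act3 (vector [vector [1,0,0], vector [0,1,0], vector [e,f,l]]) G
      = pcompose G [:?c e * XX + ?c f * YY, ?c l:]" for e f l and G :: "'a form3"
  proof (rule form3_rhom_eqI[OF rhom_act3 rhom_pcompose])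
    show "act3 A (const3 k) = pcompose (const3 k) B" for k A and B :: "'a form3"
      by (simp add: act3_const3) (simp add: const3_def)
  qed (simp_all add: act3_vars lin_form_def vector_3 rhom_simps[OF rhom_const3],
      simp_all add: vars_conv pcompose_pCons const3_def)
  have mem: "vector [vector [1,0,0], vector [0,1,0], vector [e,f,l]] \<in> stab_AGL q (axis 3 1 :: 'a^3)"
    if "e \<in> Fq q" "f \<in> Fq q" "l \<in> Fq q" "l \<noteq> 0" for e f l
    using that by (simp add: stab_axis_3 FqM_def forall_3 vector_3 det_3 Fq_closed)
  have semi: "\<exists>k. k \<noteq> 0 \<and> pcompose F [:?c e * XX + ?c f * YY, ?c l:] = smult (?c k) F"
    if efl: "e \<in> Fq q" "f \<in> Fq q" "l \<in> Fq q" "l \<noteq> 0" for e f l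
  proof -
    obtain k where "k \<noteq> 0" "act3 (vector [vector [1,0,0], vector [0,1,0], vector [e,f,l]]) F = const3 k * F"
      using inv mem[OF efl] unfolding invariant_curve_def by blast
    then show ?thesis unfolding act by (intro exI[of _ k]) (simp add: const3_def)
  qed
  have trans: "pcompose F [:?c e * XX + ?c f * YY, 1:] = F" if ef: "e \<in> Fq q" "f \<in> Fq q" for e f
  proof -
    obtain k where k: "pcompose F [:?c e * XX + ?c f * YY, 1:] = smult (?c k) F"
      using semi[OF ef Fq_closed(2) one_neq_zero] by (auto simp: rhom_1[OF c])
    have "lead_coeff (pcompose F [:?c e * XX + ?c f * YY, 1:]) = lead_coeff F"
      by (subst lead_coeff_comp) simp_all
    then have "?c k * lead_coeff F = 1 * lead_coeff F" unfolding k lead_coeff_smult by simp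
    then have "?c k = 1" using \<open>F \<noteq> 0\<close> by (subst (asm) mult_right_cancel) auto
    then show ?thesis using k by simp
  qed
  have "\<exists>s. F = pcompose s (orbN q [:XX:] [:YY:] [:0, 1:])"
  proof (rule PP.invariant_imp_pcompose_orbN[OF dickL_XY])
    show "card (?c ` {e. e ^ q = e}) = q" by (subst card_image) (auto simp: card_Fq inj_on_def)
    show "e ^ q = e" if "e \<in> ?c ` {e. e ^ q = e}" for e using that by (auto simp: poly_const_pow)
    show "pcompose F [:e * XX + f * YY, 1:] = F" if "e \<in> ?c ` {e. e ^ q = e}" "f \<in> ?c ` {e. e ^ q = e}" for e f
      using that trans by (auto simp: Fq_def)
  qed
  then obtain s where "F = pcompose s (orbN q [:XX:] [:YY:] [:0, 1:])" ..
  then have dvd1: "q\<^sup>2 dvd degree F" by (simp add: degree_pcompose PP.degree_orbN)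
  have "coeff F 0 \<noteq> 0"
  proof
    assume "coeff F 0 = 0"
    then have "varZ dvd F" using poly_eq_0_iff_dvd[of F 0] by (simp add: varZ_def poly_0_coeff_0)
    then show False using nodvd form_deg_vars by blast
  qed
  have "l ^ degree F = 1" if l: "l ^ q = l" "l \<noteq> 0" for l :: 'a
  proof -
    obtain k where k: "pcompose F [:0, ?c l:] = smult (?c k) F"
      using semi[of 0 0 l] l Fq_closed by (auto simp: Fq_def rhom_0[OF c])
    have co: "coeff (pcompose F [:0, ?c l:]) n = ?c (l ^ n) * coeff F n" for n
      by (simp add: coeff_pcompose_linear poly_const_pow)
    have "?c k * coeff F 0 = ?c 1 * coeff F 0" using co[of 0] unfolding k by simp
    then have "?c k = ?c 1" using \<open>coeff F 0 \<noteq> 0\<close> by (subst (asm) mult_right_cancel) auto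
    moreover have "?c k * lead_coeff F = ?c (l ^ degree F) * lead_coeff F" using co[of "degree F"] unfolding k by simp
    then have "?c k = ?c (l ^ degree F)" using \<open>F \<noteq> 0\<close> by (subst (asm) mult_right_cancel) auto
    ultimately show ?thesis by simp
  qed
  then have dvd2: "(q - 1) dvd degree F" by (rule Fq_exponent_dvd)
  have "coprime (q\<^sup>2) (q - 1)" using coprime_diff_one_right_nat[of q] q2 by simp
  then have dvd: "q\<^sup>2 * (q - 1) dvd degree F" using dvd1 dvd2 by (rule divides_mult[rotated 2])
  have "degree F > 0"
  proof (rule ccontr)
    assume "\<not> degree F > 0"
    then obtain g where g: "F = [:g:]" by (auto elim: degree_eq_zeroE)
    have "g \<noteq> 0" using g \<open>F \<noteq> 0\<close> by auto
    have homg: "i + j = d" if "coeff (coeff g j) i \<noteq> 0" for i j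
      using deg that unfolding form_deg_def coeff3_def g by (metis add.right_neutral coeff_pCons_0)
    have "d > 0"
    proof (rule ccontr)
      assume "\<not> d > 0"
      then have "coeff g j = 0" if "j > 0" for j using homg[of j] that by (intro poly_eqI) fastforce
      then have "degree g = 0" by (metis \<open>g \<noteq> 0\<close> leading_coeff_0_iff neq0_conv)
      then obtain h where h: "g = [:h:]" by (auto elim: degree_eq_zeroE)
      have "coeff h i = 0" if "i > 0" for i using homg[of 0 i] that \<open>\<not> d > 0\<close> h by fastforce
      then have "degree h = 0" by (metis leading_coeff_0_iff neq0_conv degree_0)
      then obtain k where "h = [:k:]" by (auto elim: degree_eq_zeroE)
      then have "F dvd 1" using g h \<open>g \<noteq> 0\<close> by (simp add: is_unit_poly_iff dvd_field_iff)
      then show False using irr irreducible_not_unit by metis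
    qed
    from binary_form_linear_factor[OF closed \<open>g \<noteq> 0\<close> homg this]
    show False
    proof
      assume "XX dvd g"
      then have "varX dvd F" unfolding vars_conv g by (rule rhom_dvd[OF rhom_const])
      then show False using nodvd form_deg_vars by blast
    next
      assume "\<exists>\<rho>. [:- [:0, \<rho>:], 1:] dvd g"
      then obtain \<rho> where "[:- [:0, \<rho>:], 1:] dvd g" ..
      then have "[:[:- [:0, \<rho>:], 1:]:] dvd F" unfolding g by (rule rhom_dvd[OF rhom_const])
      moreover have "[:[:- [:0, \<rho>:], 1:]:] = varY - const3 \<rho> * varX" by (simp add: vars_conv const3_def)
      moreover have "form_deg (const3 \<rho> * varX) 1" using form_deg_mult[OF form_deg_const3 form_deg_vars(1)] by simp
      then have "form_deg (varY - const3 \<rho> * varX) 1" by (intro form_deg_diff form_deg_vars)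
      ultimately show False using nodvd by metis
    qed
  qed
  then have "q\<^sup>2 * (q - 1) \<le> degree F" using dvd by (intro dvd_imp_le)
  moreover have "degree F \<le> d"
  proof -
    have "coeff F (degree F) \<noteq> 0" using \<open>F \<noteq> 0\<close> by simp
    then obtain i j where "coeff3 F i j (degree F) \<noteq> 0" unfolding coeff3_def by (metis leading_coeff_0_iff)
    then have "i + j + degree F = d" using deg by (simp add: form_deg_def)
    then show ?thesis by simp
  qed
  moreover have "q ^ 3 - q ^ 2 = q\<^sup>2 * (q - 1)" by (simp add: power2_eq_square power3_eq_cube algebra_simps)
  ultimately show ?thesis by simp
qed

end

theorem mainTheorem4:
  fixes p q m :: nat and P :: "'k::field ^3"
  assumes "prime p" and "m \<ge> 1" and "q = p ^ m"
    and "of_nat p = (0::'k)"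
    and "\<forall>f::'k poly. degree f > 0 \<longrightarrow> (\<exists>x. poly f x = 0)"
    and "\<forall>x::'k. \<exists>n>0. x ^ (p ^ n) = x"
    and "P \<noteq> 0" and "\<forall>i. P $ i \<in> Fq q"
  shows "q ^ 3 - q ^ 2 \<in> inv_curve_degrees (stab_AGL q P)
       \<and> (\<forall>d\<in>inv_curve_degrees (stab_AGL q P). q ^ 3 - q ^ 2 \<le> d)"
proof -
  interpret closed_frobenius p m q "TYPE('k)"
    using assms(1-5) by unfold_locales
  obtain B B' :: "'k^3^3" where B: "B \<in> FqM q" "B' \<in> FqM q" "B ** B' = mat 1" "B' ** B = mat 1" "B *v axis 3 1 = P"
    using exists_frame[OF assms(7,8)] by blast
  have B': "B' *v P = axis 3 1" unfolding B(5)[symmetric] matrix_vector_mul_assoc B(4) by simp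
  let ?S = "stab_AGL q (axis 3 1 :: 'k^3)"
  have conj: "inv_curve_degrees (stab_AGL q P) = inv_curve_degrees ?S"
    using inv_curve_degrees_conj[OF B(1-4), of "axis 3 1"] inv_curve_degrees_conj[OF B(2,1,4,3), of P]
    unfolding B' B(5) by blast
  have "2 * 2 \<le> q\<^sup>2" unfolding power2_eq_square using q2 by (intro mult_le_mono)
  moreover have "q\<^sup>2 * 1 \<le> q\<^sup>2 * (q - 1)" using q2 by (intro mult_le_mono) auto
  moreover have "q ^ 3 - q ^ 2 = q\<^sup>2 * (q - 1)" by (simp add: power2_eq_square power3_eq_cube algebra_simps)
  ultimately have "q ^ 3 - q ^ 2 \<noteq> 1" by linarith
  then have "q ^ 3 - q ^ 2 \<in> inv_curve_degrees ?S"
    using orbF_irreducible orbF_invariant form_deg_orbF[OF q2]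
    unfolding inv_curve_degrees_def homogeneous3_iff by (auto intro!: exI[of _ "orbF q varX varY varZ"])
  moreover have "q ^ 3 - q ^ 2 \<le> d" if "d \<in> inv_curve_degrees ?S" for d
    using that invariant_curve_degree_ge unfolding inv_curve_degrees_def by blast
  ultimately show ?thesis unfolding conj by blast
qed

end
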